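(* Fix an integer $r\ge 2$. Let $(f_n)_{n\ge1}$ be a sequence of monotone Boolean functions $f_n:\{0,1\}^n\to\{0,1\}$ such that, as $n\to\infty$, $T_1(\tilde f_n)\to\infty$, $T_1(\tilde f_n)=o(|R(f_n)|)$ and $|R(f_n)|=o(n)$. Then \[ T_r(f_n)=(1+o(1))\frac{T_1(f_n)}{r}. \]
   Context: A Boolean function $f:\{0,1\}^n\to\{0,1\}$ is monotone if $\mathbf{x}\le\mathbf{y}$ coordinatewise implies $f(\mathbf{x})\le f(\mathbf{y})$. A coordinate $i$ is relevant for $f$ if there exist $\mathbf{x},\mathbf{y}\in\{0,1\}^n$ differing only in coordinate $i$ with $f(\mathbf{x})\ne f(\mathbf{y})$; $R(f)$ is the set of relevant coordinates. If $R(f)=\{i_1<\dots<i_m\}$, the relevant contraction $\tilde f:\{0,1\}^m\to\{0,1\}$ is $\tilde f(\mathbf{x})=f(\mathbf{y})$ where $\mathbf{y}_{i_j}=\mathbf{x}_j$ for $j\le m$ and the other coordinates of $\mathbf{y}$ are arbitrary. For a function $g:\{0,1\}^N\to\{0,1\}$: the simple random walk $(\mathbf{X}_t)_{t=0}^N$ starts at $\mathbf{0}$ and at each step turns a uniformly random zero coordinate into 1; for an integer $r\ge1$, the $r$-choice process $(\mathbf{Y}_t)_{t=0}^N$ starts at $\mathbf{0}$, and at each step a uniformly random set of $r$ of the currently zero coordinates is proposed (all remaining zeros if fewer than $r$ remain) and an agent selects one of them according to some (possibly history-dependent) policy and turns it to 1, aiming to reach $g^{-1}(1)$ as quickly as possible.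 Define $T_1(g)=\min\{t:\Pr(g(\mathbf{X}_t)=1)\ge1/2\}$ and $T_r(g)=\min\{t:\Pr(g(\mathbf{Y}_t)=1)\ge1/2\}$, where for $T_r$ the agent uses a policy minimizing this quantity. *)

theory Defs
  imports "HOL-Probability.Probability" "HOL-Library.Landau_Symbols"
begin

text \<open>
  A point of \<open>{0,1}\<^sup>n\<close> is represented by the set \<open>x \<subseteq> {..<n}\<close> of its coordinates
  equal to 1 (coordinates are numbered from 0), so that \<open>x \<subseteq> y\<close> is the coordinatewise order.
  A Boolean function on \<open>{0,1}\<^sup>n\<close> is a predicate on sets; its values outside
  \<open>Pow {..<n}\<close> play no role.
\<close>

definition monotone_boolean :: "nat \<Rightarrow> (nat set \<Rightarrow> bool) \<Rightarrow> bool" where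
  "monotone_boolean n f \<longleftrightarrow>
     (\<forall>x y. x \<subseteq> y \<longrightarrow> y \<subseteq> {..<n} \<longrightarrow> f x \<longrightarrow> f y)"

definition relevant :: "nat \<Rightarrow> (nat set \<Rightarrow> bool) \<Rightarrow> nat set" where
  "relevant n f =
     {i. i < n \<and> (\<exists>x y. x \<subseteq> {..<n} \<and> y \<subseteq> {..<n} \<and>
            (\<forall>j. j \<noteq> i \<longrightarrow> (j \<in> x \<longleftrightarrow> j \<in> y)) \<and> f x \<noteq> f y)}"

text \<open>
  The irrelevant coordinates are filled with 0; the lemma
  \<open>relevant_contraction_eq\<close> below shows that every other filling gives the same value.
\<close>

definition relevant_contraction :: "nat \<Rightarrow> (nat set \<Rightarrow> bool) \<Rightarrow> nat set \<Rightarrow> bool" where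
  "relevant_contraction n f x = f ((\<lambda>j. sorted_list_of_set (relevant n f) ! j) ` x)"

lemma relevant_agree:
  assumes "y \<subseteq> {..<n}" "z \<subseteq> {..<n}"
    and "\<And>i. i \<in> relevant n f \<Longrightarrow> i \<in> y \<longleftrightarrow> i \<in> z"
  shows "f y = f z"
proof -
  have "finite y" "finite z"
    using assms(1,2) by (auto intro: finite_subset)
  then have "finite (y - z \<union> (z - y))" by simp
  then show ?thesis
    using assms
  proof (induction "y - z \<union> (z - y)" arbitrary: y rule: finite_induct)
    case empty
    then have "y = z" by auto
    then show ?case by simp
  next
    case (insert i D)
    define y' where "y' = (if i \<in> y then y - {i} else insert i y)"
    have i: "i \<in> y \<longleftrightarrow> i \<notin> z" using insert.hyps(4) by auto
    have "i < n" using i insert.prems(1,2) by (cases "i \<in> y") auto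
    have y': "y' \<subseteq> {..<n}" using \<open>i < n\<close> insert.prems(1) by (auto simp: y'_def)
    have diff: "j \<in> y \<longleftrightarrow> j \<in> y'" if "j \<noteq> i" for j
      using that by (simp add: y'_def)
    have nr: "i \<notin> relevant n f" using i insert.prems(3) by auto
    have "y' - z \<union> (z - y') = (y - z \<union> (z - y)) - {i}"
      using i by (cases "i \<in> y") (auto simp: y'_def)
    also have "\<dots> = D"
      unfolding insert.hyps(4)[symmetric] using insert.hyps(2) by simp
    finally have D: "D = y' - z \<union> (z - y')" by (rule sym)
    have "j \<in> y' \<longleftrightarrow> j \<in> z" if "j \<in> relevant n f" for j
    proof -
      have "j \<noteq> i" using that nr by auto
      then show ?thesis using diff[of j] insert.prems(3)[OF that] by simp
    qed
    then have "f y' = f z" by (rule insert.hyps(3)[OF D y' insert.prems(2)])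
    moreover have "f y = f y'"
    proof (rule ccontr)
      assume "f y \<noteq> f y'"
      then have "i \<in> relevant n f"
        unfolding relevant_def
        using \<open>i < n\<close> insert.prems(1) y' diff by (intro CollectI conjI exI[of _ y] exI[of _ y']) auto
      then show False using nr by simp
    qed
    ultimately show ?case by simp
  qed
qed

lemma relevant_contraction_eq:
  assumes x: "x \<subseteq> {..<card (relevant n f)}" and y: "y \<subseteq> {..<n}"
    and xy: "\<And>j. j < card (relevant n f) \<Longrightarrow>
               sorted_list_of_set (relevant n f) ! j \<in> y \<longleftrightarrow> j \<in> x"
  shows "relevant_contraction n f x = f y"
proof -
  define R where "R = relevant n f"
  define l where "l = sorted_list_of_set R"
  have R: "R \<subseteq> {..<n}" by (auto simp: relevant_def R_def)
  then have fin: "finite R" by (rule finite_subset) simp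
  have l: "set l = R" "length l = card R" "distinct l"
    using fin by (simp_all add: l_def)
  have xR: "j < length l" if "j \<in> x" for j
    using that x l(2) by (auto simp: R_def)
  have agree: "i \<in> (!) l ` x \<longleftrightarrow> i \<in> y" if "i \<in> R" for i
  proof -
    have "i \<in> set l" using that l(1) by simp
    then obtain k where k: "k < length l" "i = l ! k"
      by (metis in_set_conv_nth)
    have "k \<in> x" if j: "j \<in> x" "i = l ! j" for j
      using nth_eq_iff_index_eq[OF l(3) xR[OF j(1)] k(1)] j k(2) by simp
    then have "i \<in> (!) l ` x \<longleftrightarrow> k \<in> x" using k(2) by auto
    also have "\<dots> \<longleftrightarrow> i \<in> y" using xy[of k] k l(2) by (simp add: l_def R_def)
    finally show ?thesis .
  qed
  have "(!) l ` x \<subseteq> {..<n}" using xR R l(1) nth_mem by fastforce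
  then have "f ((!) l ` x) = f y"
    by (rule relevant_agree[OF _ y agree[unfolded R_def]])
  then show ?thesis by (simp add: relevant_contraction_def l_def R_def)
qed

text \<open>
  \<open>random_walk N t\<close> is the law of the walk at time \<open>t\<close>. Only times \<open>t \<le> N\<close> are ever used;
  after the all-ones point has been reached the process is frozen.
\<close>

primrec random_walk :: "nat \<Rightarrow> nat \<Rightarrow> nat set pmf" where
  "random_walk N 0 = return_pmf {}"
| "random_walk N (Suc t) =
     bind_pmf (random_walk N t) (\<lambda>x.
       if {..<N} - x = {} then return_pmf x
       else map_pmf (\<lambda>i. insert i x) (pmf_of_set ({..<N} - x)))"

text \<open>
  A history lists the pairs (proposed set, selected coordinate) of all past steps, most recent
  first. A policy maps the history and the currently proposed set to a law on that set;
  deterministic policies are those whose laws are point masses.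
\<close>

type_synonym history = "(nat set \<times> nat) list"

type_synonym policy = "history \<Rightarrow> nat set \<Rightarrow> nat pmf"

definition valid_policy :: "policy \<Rightarrow> bool" where
  "valid_policy \<pi> \<longleftrightarrow> (\<forall>h S. finite S \<longrightarrow> S \<noteq> {} \<longrightarrow> set_pmf (\<pi> h S) \<subseteq> S)"

definition state :: "history \<Rightarrow> nat set" where
  "state h = snd ` set h"

primrec choice_process :: "nat \<Rightarrow> policy \<Rightarrow> nat \<Rightarrow> nat \<Rightarrow> history pmf" where
  "choice_process r \<pi> N 0 = return_pmf []"
| "choice_process r \<pi> N (Suc t) =
     bind_pmf (choice_process r \<pi> N t) (\<lambda>h.
       let Z = {..<N} - state h in
       if Z = {} then return_pmf h
       else bind_pmf (pmf_of_set {S. S \<subseteq> Z \<and> card S = min r (card Z)}) (\<lambda>S.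
              map_pmf (\<lambda>i. (S, i) # h) (\<pi> h S)))"

text \<open>
  The minima below are over nonempty sets as soon as \<open>g\<close> takes the value 1 at the all-ones point
  (both processes are there at time \<open>N\<close>), that is, for every monotone \<open>g\<close> except the constant 0.
  Minimizing over policies the first time at which the success probability is at least 1/2 amounts
  to taking the first time at which this can be achieved by some policy.
\<close>

definition T_walk :: "nat \<Rightarrow> (nat set \<Rightarrow> bool) \<Rightarrow> nat" where
  "T_walk N g =
     (LEAST t. t \<le> N \<and> measure_pmf.prob (random_walk N t) {x. g x} \<ge> 1/2)"

definition T_choice :: "nat \<Rightarrow> nat \<Rightarrow> (nat set \<Rightarrow> bool) \<Rightarrow> nat" where
  "T_choice r N g =
     (LEAST t. t \<le> N \<and> (\<exists>\<pi>. valid_policy \<pi> \<and>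
        measure_pmf.prob (choice_process r \<pi> N t) {h. g (state h)} \<ge> 1/2))"

end

theory Submission
  imports Defs
begin

text \<open>
  Lower bound: whichever of the \<open>r\<close> proposed coordinates is selected, setting all of them is at
  least as good, and this is \<open>r\<close> steps of the simple walk; hence \<open>T\<^sub>1(f) \<le> r T\<^sub>r(f)\<close>.

  Upper bound: let \<open>p\<close> be the bias at which the product measure gives \<open>f = 1\<close> probability \<open>1/2\<close>. It
  depends only on the relevant coordinates. If \<open>d\<close> is the \<open>p\<close>-biased probability of \<open>f = 0\<close>, then at
  bias \<open>1 - (1 - p)\<^sup>\<alpha> \<le> \<alpha>p\<close> this probability is at most \<open>d\<^sup>\<alpha>\<close> (a tensor-power induction on the
  dimension, using that \<open>f = 0\<close> is a decreasing event). So a constant factor in \<open>p\<close>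
  moves the probability away from \<open>1/2\<close> by a constant, and Chebyshev's inequality shows that the
  hitting times are \<open>(1 + o(1)) p |V|\<close> for both \<open>V = [n]\<close> and \<open>V = R(f)\<close>. Since \<open>|R(f)| = o(n)\<close> and
  few relevant coordinates are used up, each step of a policy that takes a random relevant coordinate
  whenever one is proposed sets a relevant coordinate with probability about \<open>r |R(f)| / n\<close>, so
  that \<open>p |R(f)|\<close> of them are collected in time about \<open>p n / r\<close>.
\<close>

section \<open>The averaging operator of the random walk\<close>

text \<open>The transition operator acting on functions: \<open>walk_avg V k g X\<close> is the
  expected value of \<open>g\<close> after \<open>k\<close> further steps from \<open>X\<close>,
  with the full set absorbing. A general ground set allows both \<open>[n]\<close> and the relevant
  set.\<close>

definition walk_step :: "'a set \<Rightarrow> ('a set \<Rightarrow> real) \<Rightarrow> 'a set \<Rightarrow> real" where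
  "walk_step V g X =
     (if V \<subseteq> X then g X else (\<Sum>i\<in>V - X. g (insert i X)) / card (V - X))"

abbreviation walk_avg :: "'a set \<Rightarrow> nat \<Rightarrow> ('a set \<Rightarrow> real) \<Rightarrow> 'a set \<Rightarrow> real" where
  "walk_avg V k \<equiv> walk_step V ^^ k"

lemma mono_on_PowD:
  fixes g :: "'a set \<Rightarrow> real"
  shows "mono_on (Pow V) g \<Longrightarrow> X \<subseteq> Y \<Longrightarrow> Y \<subseteq> V \<Longrightarrow> g X \<le> g Y"
  by (auto simp: monotone_on_def)

lemma walk_step_ge_const:
  assumes "finite V" "X \<subseteq> V" "\<And>i. i \<in> V - X \<Longrightarrow> c \<le> g (insert i X)" "V - X = {} \<Longrightarrow> c \<le> g X"
  shows "c \<le> walk_step V g X"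
proof (cases "V - X = {}")
  case False
  then have "card (V - X) > 0" using assms(1) by (simp add: card_gt_0_iff)
  moreover have "c * card (V - X) \<le> (\<Sum>i\<in>V - X. g (insert i X))"
    using sum_bounded_below[of "V - X" c "\<lambda>i. g (insert i X)"] assms(3)
    by (simp add: mult.commute)
  ultimately show ?thesis using False by (simp add: walk_step_def field_simps)
qed (use assms(4) in \<open>simp add: walk_step_def\<close>)

lemma walk_step_mono:
  assumes "\<And>i. i \<in> V - X \<Longrightarrow> g (insert i X) \<le> h (insert i X)" "g X \<le> h X"
  shows "walk_step V g X \<le> walk_step V h X"
  unfolding walk_step_def using assms by (auto intro!: divide_right_mono sum_mono)

lemma walk_step_const: "finite V \<Longrightarrow> walk_step V (\<lambda>_. c) X = c"
  by (auto simp: walk_step_def)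

lemma walk_avg_le_1:
  assumes "finite V" "\<And>X. g X \<le> 1"
  shows "walk_avg V k g X \<le> 1"
proof (induction k arbitrary: X)
  case (Suc k)
  have "walk_step V (walk_avg V k g) X \<le> walk_step V (\<lambda>_. 1) X"
    by (intro walk_step_mono Suc)
  then show ?case using assms by (simp add: walk_step_const)
qed (use assms in auto)

lemma walk_avg_ge_0:
  assumes "finite V" "\<And>X. g X \<ge> 0"
  shows "walk_avg V k g X \<ge> 0"
proof (induction k arbitrary: X)
  case (Suc k)
  have "walk_step V (\<lambda>_. 0) X \<le> walk_step V (walk_avg V k g) X"
    by (intro walk_step_mono Suc)
  then show ?case using assms by (simp add: walk_step_const)
qed (use assms in auto)

lemma walk_step_ge:
  assumes "finite V" "mono_on (Pow V) g" "X \<subseteq> V"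
  shows "g X \<le> walk_step V g X"
  using assms by (intro walk_step_ge_const) (auto intro!: mono_on_PowD[where V = V])

text \<open>A coupling argument. From \<open>X\<close> the step picks either \<open>j\<close>, whose
  value \<open>g (insert j X)\<close> is at most \<open>?A\<close>, or an element of
  \<open>W\<close>; on \<open>W\<close> monotonicity compares termwise with the step from
  \<open>insert j X\<close>, whose average is \<open>?A\<close>.\<close>

lemma walk_step_insert_ge:
  assumes "finite V" "mono_on (Pow V) g" "X \<subseteq> V" "j \<in> V - X"
  shows "walk_step V g X \<le> walk_step V g (insert j X)"
proof -
  let ?A = "walk_step V g (insert j X)"
  define W where "W = V - insert j X"
  have VX: "V - X = insert j W" "j \<notin> W" "finite W" using assms by (auto simp: W_def)
  have 1: "g (insert j X) \<le> ?A"
    using assms by (intro walk_step_ge) auto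
  have 2: "(\<Sum>i\<in>W. g (insert i X)) \<le> ?A * card W"
  proof (cases "W = {}")
    case False
    have "(\<Sum>i\<in>W. g (insert i X)) \<le> (\<Sum>i\<in>W. g (insert i (insert j X)))"
      using assms VX by (intro sum_mono mono_on_PowD[OF assms(2)]) auto
    also have "\<dots> = ?A * card W"
      using False VX Diff_eq_empty_iff[of V "insert j X"] by (simp add: walk_step_def W_def[symmetric])
    finally show ?thesis .
  qed simp
  have "(\<Sum>i\<in>V - X. g (insert i X)) = g (insert j X) + (\<Sum>i\<in>W. g (insert i X))"
    using VX by simp
  also have "\<dots> \<le> ?A * card (V - X)"
    using 1 2 VX by (simp add: algebra_simps)
  finally have le: "(\<Sum>i\<in>V - X. g (insert i X)) \<le> ?A * card (V - X)" .
  have "card (V - X) > 0" "V - X \<noteq> {}" using VX by auto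
  then show ?thesis using le unfolding walk_step_def[of V g X] by (simp add: field_simps)
qed

lemma mono_on_walk_step:
  assumes "finite V" "mono_on (Pow V) g"
  shows "mono_on (Pow V) (walk_step V g)"
proof (rule monotone_onI)
  fix X Y assume "X \<in> Pow V" "Y \<in> Pow V" "X \<subseteq> Y"
  then have X: "X \<subseteq> V" and Y: "Y \<subseteq> V" by auto
  have "finite (Y - X)" using Y assms(1) by (auto intro: finite_subset)
  have "walk_step V g X \<le> walk_step V g (X \<union> D)" if "D \<subseteq> Y - X" for D
    using finite_subset[OF that \<open>finite (Y - X)\<close>] that
  proof (induction D rule: finite_induct)
    case (insert j D)
    then have "walk_step V g X \<le> walk_step V g (X \<union> D)" by auto
    also have "\<dots> \<le> walk_step V g (insert j (X \<union> D))"
      using insert X Y assms by (intro walk_step_insert_ge) auto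
    finally show ?case by simp
  qed simp
  from this[of "Y - X"] show "walk_step V g X \<le> walk_step V g Y"
    using \<open>X \<subseteq> Y\<close> by (simp add: Un_absorb1)
qed

lemma mono_on_walk_avg:
  assumes "finite V" "mono_on (Pow V) g"
  shows "mono_on (Pow V) (walk_avg V k g)"
  by (induction k) (use assms in \<open>auto intro: mono_on_walk_step\<close>)

text \<open>Iterates stay monotone and a step only adds elements, so each further application can
  only raise the value.\<close>

lemma walk_avg_mono_time:
  assumes "finite V" "mono_on (Pow V) g" "X \<subseteq> V" "k \<le> l"
  shows "walk_avg V k g X \<le> walk_avg V l g X"
  using assms(4)
proof (induction rule: dec_induct)
  case (step l)
  note step.IH
  also have "walk_avg V l g X \<le> walk_step V (walk_avg V l g) X"
    using assms by (intro walk_step_ge mono_on_walk_avg)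
  finally show ?case by simp
qed simp

lemma walk_avg_full: "walk_avg V k g V = g V"
  by (induction k) (auto simp: walk_step_def)

lemma walk_avg_absorbed:
  assumes "finite V" "X \<subseteq> V" "card (V - X) \<le> k"
  shows "walk_avg V k g X = g V"
  using assms(2,3)
proof (induction k arbitrary: X)
  case 0
  then have "X = V" using assms(1) by auto
  then show ?case by simp
next
  case (Suc k)
  show ?case
  proof (cases "V - X = {}")
    case True
    then have "X = V" using Suc by auto
    then show ?thesis by (simp only: walk_avg_full)
  next
    case False
    have "walk_avg V k g (insert i X) = g V" if "i \<in> V - X" for i
    proof (rule Suc.IH)
      have "V - insert i X = (V - X) - {i}" by auto
      then show "card (V - insert i X) \<le> k"
        using Suc.prems that assms(1) by (simp add: card_Diff_singleton)
    qed (use that Suc.prems in auto)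
    then have "walk_avg V (Suc k) g X = (\<Sum>i\<in>V - X. g V) / card (V - X)"
      using False by (simp add: walk_step_def)
    also have "\<dots> = g V" using False assms(1) by simp
    finally show ?thesis .
  qed
qed

section \<open>Walk steps as uniform subsets\<close>

text \<open>Double counting of pairs \<open>(S, i)\<close> with \<open>i\<close> in
  \<open>S\<close>: each set of size \<open>Suc k\<close> arises once for each of its
  elements.\<close>

lemma sum_subsets_insert:
  fixes h :: "'a set \<Rightarrow> real"
  assumes "finite Z"
  shows "(\<Sum>i\<in>Z. \<Sum>S\<in>{S. S \<subseteq> Z - {i} \<and> card S = k}. h (insert i S)) =
         real (Suc k) * (\<Sum>S\<in>{S. S \<subseteq> Z \<and> card S = Suc k}. h S)"
proof -
  have fin: "finite {S. S \<subseteq> A \<and> card S = l}" if "finite A" for A :: "'a set" and l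
    using that by simp
  have "(\<Sum>i\<in>Z. \<Sum>S\<in>{S. S \<subseteq> Z - {i} \<and> card S = k}. h (insert i S)) =
        (\<Sum>(i, S)\<in>(SIGMA i:Z. {S. S \<subseteq> Z - {i} \<and> card S = k}). h (insert i S))"
    using assms by (simp add: sum.Sigma)
  also have "\<dots> = (\<Sum>(S, i)\<in>(SIGMA S:{S. S \<subseteq> Z \<and> card S = Suc k}. S). h S)"
  proof (rule sum.reindex_bij_witness[where
        i = "\<lambda>(S, i). (i, S - {i})" and j = "\<lambda>(i, S). (insert i S, i)"])
    fix a assume "a \<in> (SIGMA i:Z. {S. S \<subseteq> Z - {i} \<and> card S = k})"
    moreover from this have "snd a \<subseteq> Z" by auto
    then have "finite (snd a)" using assms by (rule finite_subset)
    ultimately show "(case case a of (i, S) \<Rightarrow> (insert i S, i) of (S, i) \<Rightarrow> (i, S - {i})) = a"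
      "(case a of (i, S) \<Rightarrow> (insert i S, i)) \<in> (SIGMA S:{S. S \<subseteq> Z \<and> card S = Suc k}. S)"
      "(case case a of (i, S) \<Rightarrow> (insert i S, i) of (S, i) \<Rightarrow> h S) = (case a of (i, S) \<Rightarrow> h (insert i S))"
      by (auto simp: card_insert_if)
  next
    fix b assume "b \<in> (SIGMA S:{S. S \<subseteq> Z \<and> card S = Suc k}. S)"
    then show "(case case b of (S, i) \<Rightarrow> (i, S - {i}) of (i, S) \<Rightarrow> (insert i S, i)) = b"
      "(case b of (S, i) \<Rightarrow> (i, S - {i})) \<in> (SIGMA i:Z. {S. S \<subseteq> Z - {i} \<and> card S = k})"
      by (auto simp: insert_absorb)
  qed
  also have "\<dots> = (\<Sum>S\<in>{S. S \<subseteq> Z \<and> card S = Suc k}. \<Sum>i\<in>S. h S)"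
    using assms by (subst sum.Sigma) (auto intro: finite_subset)
  also have "\<dots> = real (Suc k) * (\<Sum>S\<in>{S. S \<subseteq> Z \<and> card S = Suc k}. h S)"
    by (simp add: sum_distrib_left)
  finally show ?thesis .
qed

text \<open>Sampling without replacement: \<open>k\<close> successive uniform choices form a uniform
  \<open>k\<close>-subset. The first choice is split off, and the absorption identity for binomials
  gives the normalisation. This links the walk both to proposals and to slices of the product
  measure.\<close>

lemma walk_avg_eq_subset_avg:
  assumes "finite V" "X \<subseteq> V" "k \<le> card (V - X)"
  shows "walk_avg V k g X =
    (\<Sum>S\<in>{S. S \<subseteq> V - X \<and> card S = k}. g (X \<union> S)) / (card (V - X) choose k)"
  using assms(2,3)
proof (induction k arbitrary: X)
  case 0
  have "{S. S \<subseteq> V - X \<and> card S = 0} = {{}}"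
    using assms(1) by (auto dest: finite_subset)
  then show ?case by simp
next
  case (Suc k)
  define Z where "Z = V - X"
  have finZ: "finite Z" using assms(1) by (simp add: Z_def)
  have Z: "card Z > 0" "Z \<noteq> {}" using Suc.prems by (auto simp: Z_def)
  have step: "walk_avg V k g (insert i X) =
      (\<Sum>S\<in>{S. S \<subseteq> Z - {i} \<and> card S = k}. g (X \<union> insert i S)) / (card Z - 1 choose k)"
    if "i \<in> Z" for i
  proof -
    have eq: "V - insert i X = Z - {i}" by (auto simp: Z_def)
    have "walk_avg V k g (insert i X) =
      (\<Sum>S\<in>{S. S \<subseteq> V - insert i X \<and> card S = k}. g (insert i X \<union> S)) /
      (card (V - insert i X) choose k)"
      using Suc.prems that finZ
      by (intro Suc.IH) (auto simp: eq card_Diff_singleton Z_def[symmetric], auto simp: Z_def)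
    then show ?thesis using that by (simp add: eq)
  qed
  have "walk_avg V (Suc k) g X = (\<Sum>i\<in>Z. walk_avg V k g (insert i X)) / card Z"
    using Z by (simp add: walk_step_def Z_def)
  also have "\<dots> = (\<Sum>i\<in>Z. \<Sum>S\<in>{S. S \<subseteq> Z - {i} \<and> card S = k}. g (X \<union> insert i S)) /
      (card Z * (card Z - 1 choose k))"
    by (simp add: step sum_divide_distrib[symmetric])
  also have "\<dots> = real (Suc k) * (\<Sum>S\<in>{S. S \<subseteq> Z \<and> card S = Suc k}. g (X \<union> S)) /
      (card Z * (card Z - 1 choose k))"
    using sum_subsets_insert[OF finZ, where h = "\<lambda>S. g (X \<union> S)"] by simp
  also have "card Z * (card Z - 1 choose k) = Suc k * (card Z choose Suc k)"
    using Suc_times_binomial_eq[of "card Z - 1" k] Z by (simp add: mult.commute)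
  finally show ?case by (simp add: Z_def del: of_nat_Suc mult_Suc)
qed

text \<open>Invariance under relabelling, needed to pass from the contraction to the relevant
  coordinates themselves.\<close>

lemma walk_avg_image:
  assumes "inj_on e V" "X \<subseteq> V"
  shows "walk_avg (e ` V) k g (e ` X) = walk_avg V k (\<lambda>x. g (e ` x)) X"
  using assms(2)
proof (induction k arbitrary: X)
  case (Suc k)
  have eq: "e ` V - e ` X = e ` (V - X)"
    using inj_on_image_set_diff[OF assms(1), of V X] Suc.prems by auto
  have inj: "inj_on e (V - X)" using assms(1) by (rule inj_on_subset) auto
  have "walk_avg (e ` V) k g (insert (e i) (e ` X)) = walk_avg V k (\<lambda>x. g (e ` x)) (insert i X)"
    if "i \<in> V - X" for i
    using Suc.IH[of "insert i X"] Suc.prems that by simp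
  then have "(\<Sum>i\<in>V - X. walk_avg (e ` V) k g (insert (e i) (e ` X))) =
      (\<Sum>i\<in>V - X. walk_avg V k (\<lambda>x. g (e ` x)) (insert i X))"
    by (intro sum.cong) auto
  moreover have "e ` V \<subseteq> e ` X \<longleftrightarrow> V \<subseteq> X"
    by (metis Diff_eq_empty_iff eq image_is_empty)
  moreover have "V \<subseteq> X \<Longrightarrow> X = V" using Suc.prems by auto
  ultimately show ?case
    using Suc.IH[OF Suc.prems]
    by (simp add: walk_step_def[of _ "walk_avg _ _ _"] eq sum.reindex[OF inj] card_image[OF inj])
qed simp

section \<open>The walk and the choice process\<close>

lemma expectation_bind_finite:
  fixes h :: "'b \<Rightarrow> real"
  assumes "finite (set_pmf p)" "\<And>x. x \<in> set_pmf p \<Longrightarrow> finite (set_pmf (f x))"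
  shows "measure_pmf.expectation (bind_pmf p f) h =
         measure_pmf.expectation p (\<lambda>x. measure_pmf.expectation (f x) h)"
  using assms by (subst pmf_expectation_bind[of "set_pmf p"])
    (auto simp: integral_measure_pmf[of "set_pmf p"])

lemma random_walk_support:
  "finite (set_pmf (random_walk N t)) \<and> (\<forall>x\<in>set_pmf (random_walk N t). x \<subseteq> {..<N})"
proof (induction t)
  case (Suc t)
  have "finite (set_pmf (if {..<N} - x = {} then return_pmf x
       else map_pmf (\<lambda>i. insert i x) (pmf_of_set ({..<N} - x))))" for x
    by auto
  moreover have "y \<subseteq> {..<N}" if "x \<subseteq> {..<N}" "y \<in> set_pmf (if {..<N} - x = {} then return_pmf x
       else map_pmf (\<lambda>i. insert i x) (pmf_of_set ({..<N} - x)))" for x y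
    using that by (auto split: if_splits)
  ultimately show ?case using Suc by simp
qed simp

text \<open>Carrying an arbitrary number \<open>k\<close> of operator applications makes the
  induction close: unfolding the last step of the walk turns \<open>k\<close> into
  \<open>Suc k\<close>.\<close>

lemma expectation_random_walk:
  "measure_pmf.expectation (random_walk N t) (walk_avg {..<N} k g) = walk_avg {..<N} (t + k) g {}"
proof (induction t arbitrary: k)
  case (Suc t)
  let ?V = "{..<N}"
  let ?K = "\<lambda>x. if ?V - x = {} then return_pmf x
       else map_pmf (\<lambda>i. insert i x) (pmf_of_set (?V - x))"
  have "measure_pmf.expectation (random_walk N (Suc t)) (walk_avg ?V k g) =
      measure_pmf.expectation (random_walk N t)
        (\<lambda>x. measure_pmf.expectation (?K x) (walk_avg ?V k g))"
    unfolding random_walk.simps using random_walk_support[of N t]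
    by (intro expectation_bind_finite) auto
  also have "(\<lambda>x. measure_pmf.expectation (?K x) (walk_avg ?V k g)) = walk_avg ?V (Suc k) g"
    by (auto simp: fun_eq_iff walk_step_def[of _ "walk_avg _ _ _"] integral_pmf_of_set)
  finally show ?case using Suc.IH[of "Suc k"] by simp
qed simp

lemma prob_random_walk:
  "measure_pmf.prob (random_walk N t) {x. g x} = walk_avg {..<N} t (\<lambda>x. of_bool (g x)) {}"
proof -
  have "measure_pmf.prob (random_walk N t) {x. g x} =
      measure_pmf.expectation (random_walk N t) (indicator {x. g x})"
    by simp
  also have "indicator {x. g x} = walk_avg {..<N} 0 (\<lambda>x. of_bool (g x) :: real)"
    by (auto simp: indicator_def fun_eq_iff)
  finally show ?thesis using expectation_random_walk[of N t 0] by simp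
qed

section \<open>Potential bounds for the choice process\<close>

definition proposals :: "nat \<Rightarrow> nat set \<Rightarrow> nat set set" where
  "proposals r Z = {S. S \<subseteq> Z \<and> card S = min r (card Z)}"

lemma finite_proposals: "finite Z \<Longrightarrow> finite (proposals r Z)"
  by (auto simp: proposals_def)

lemma card_proposals: "finite Z \<Longrightarrow> card (proposals r Z) = card Z choose min r (card Z)"
  by (simp add: proposals_def n_subsets)

lemma card_proposals_pos: "finite Z \<Longrightarrow> card (proposals r Z) > 0"
  by (simp add: card_proposals)

lemma proposals_nonempty: "finite Z \<Longrightarrow> proposals r Z \<noteq> {}"
  using card_proposals_pos[of Z r] by (metis card.empty less_irrefl)

lemma proposalsD:
  assumes "S \<in> proposals r Z" "finite Z" "Z \<noteq> {}" "r \<ge> 1"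
  shows "S \<subseteq> Z" "finite S" "S \<noteq> {}"
proof -
  show "S \<subseteq> Z" using assms(1) by (simp add: proposals_def)
  then show "finite S" using assms(2) by (rule finite_subset)
  have "card S = min r (card Z)" "card Z > 0"
    using assms by (simp_all add: proposals_def card_gt_0_iff)
  then show "S \<noteq> {}" using assms(4) by auto
qed

lemma state_Cons: "state ((S, i) # h) = insert i (state h)"
  by (simp add: state_def)

lemma state_Nil: "state [] = {}"
  by (simp add: state_def)

definition choice_kernel :: "nat \<Rightarrow> policy \<Rightarrow> nat \<Rightarrow> history \<Rightarrow> history pmf" where
  "choice_kernel r \<pi> N h =
     bind_pmf (pmf_of_set (proposals r ({..<N} - state h))) (\<lambda>S.
       map_pmf (\<lambda>i. (S, i) # h) (\<pi> h S))"

lemma choice_process_Suc: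
  "choice_process r \<pi> N (Suc t) =
     bind_pmf (choice_process r \<pi> N t) (\<lambda>h.
       if {..<N} - state h = {} then return_pmf h else choice_kernel r \<pi> N h)"
  unfolding choice_process.simps Let_def proposals_def choice_kernel_def ..

text \<open>The conditional expectation of \<open>\<Phi>\<close> at the next state. The policy may
  use all of \<open>h\<close>, but \<open>\<Phi>\<close> sees only the set of ones.\<close>

definition choice_step :: "nat \<Rightarrow> policy \<Rightarrow> nat \<Rightarrow> (nat set \<Rightarrow> real) \<Rightarrow> history \<Rightarrow> real" where
  "choice_step r \<pi> N \<Phi> h =
     (\<Sum>S\<in>proposals r ({..<N} - state h). measure_pmf.expectation (\<pi> h S) (\<lambda>i. \<Phi> (insert i (state h)))) /
     card (proposals r ({..<N} - state h))"

context
  fixes \<pi> :: policy and r N :: nat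
  assumes valid: "valid_policy \<pi>" and r: "r \<ge> 1"
begin

lemma policy_support:
  assumes "S \<in> proposals r Z" "finite Z" "Z \<noteq> {}"
  shows "set_pmf (\<pi> h S) \<subseteq> S" "set_pmf (\<pi> h S) \<subseteq> Z" "finite (set_pmf (\<pi> h S))"
proof -
  note S = proposalsD[OF assms r]
  then show *: "set_pmf (\<pi> h S) \<subseteq> S" using valid by (auto simp: valid_policy_def)
  with S show "set_pmf (\<pi> h S) \<subseteq> Z" "finite (set_pmf (\<pi> h S))"
    by (auto intro: finite_subset)
qed

context
  fixes h :: history
  assumes unfinished: "{..<N} - state h \<noteq> {}"
begin

lemma set_choice_kernel:
  "set_pmf (choice_kernel r \<pi> N h) =
     (\<Union>S\<in>proposals r ({..<N} - state h). (\<lambda>i. (S, i) # h) ` set_pmf (\<pi> h S))"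
  by (simp add: choice_kernel_def finite_proposals proposals_nonempty)

lemma finite_choice_kernel: "finite (set_pmf (choice_kernel r \<pi> N h))"
  unfolding set_choice_kernel using unfinished
  by (intro finite_UN_I finite_imageI finite_proposals policy_support(3)) auto

lemma choice_kernel_support:
  assumes "h' \<in> set_pmf (choice_kernel r \<pi> N h)" "state h \<subseteq> {..<N}"
  shows "state h' \<subseteq> {..<N}"
proof -
  obtain S i where S: "S \<in> proposals r ({..<N} - state h)" "i \<in> set_pmf (\<pi> h S)" "h' = (S, i) # h"
    using assms(1) unfolding set_choice_kernel by blast
  then have "i \<in> {..<N}" using policy_support(2)[OF S(1) _ unfinished] by blast
  then show ?thesis using assms(2) S(3) by (simp add: state_Cons)
qed

lemma expectation_choice_kernel:
  "measure_pmf.expectation (choice_kernel r \<pi> N h) (\<lambda>h. \<Phi> (state h)) = choice_step r \<pi> N \<Phi> h"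
proof -
  let ?P = "proposals r ({..<N} - state h)"
  have "measure_pmf.expectation (choice_kernel r \<pi> N h) (\<lambda>h. \<Phi> (state h)) =
    (\<Sum>S\<in>?P. measure_pmf.expectation (map_pmf (\<lambda>i. (S, i) # h) (\<pi> h S)) (\<lambda>h. \<Phi> (state h)) /\<^sub>R card ?P)"
    unfolding choice_kernel_def using policy_support(3)[OF _ _ unfinished]
    by (intro pmf_expectation_bind_pmf_of_set) (simp_all add: finite_proposals proposals_nonempty)
  then show ?thesis
    by (simp add: choice_step_def state_Cons divide_inverse sum_distrib_left mult.commute)
qed

end

lemma choice_process_support:
  "finite (set_pmf (choice_process r \<pi> N t)) \<and>
    (\<forall>h\<in>set_pmf (choice_process r \<pi> N t). state h \<subseteq> {..<N})"
proof (induction t)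
  case 0
  then show ?case by (simp add: state_Nil)
next
  case (Suc t)
  define K where "K h = (if {..<N} - state h = {} then return_pmf h else choice_kernel r \<pi> N h)" for h
  have set_Suc: "set_pmf (choice_process r \<pi> N (Suc t)) =
      (\<Union>h\<in>set_pmf (choice_process r \<pi> N t). set_pmf (K h))"
    unfolding choice_process_Suc K_def by (rule set_bind_pmf)
  have "finite (set_pmf (K h))" for h
    unfolding K_def using finite_choice_kernel by simp
  moreover have "state h' \<subseteq> {..<N}" if "state h \<subseteq> {..<N}" "h' \<in> set_pmf (K h)" for h h'
    using that choice_kernel_support unfolding K_def by (simp split: if_splits)
  ultimately show ?case using Suc unfolding set_Suc by blast
qed

lemma expectation_choice_process_Suc:
  "measure_pmf.expectation (choice_process r \<pi> N (Suc t)) (\<lambda>h. \<Phi> (state h)) =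
    measure_pmf.expectation (choice_process r \<pi> N t)
      (\<lambda>h. if {..<N} - state h = {} then \<Phi> (state h) else choice_step r \<pi> N \<Phi> h)"
proof -
  define K where "K h = (if {..<N} - state h = {} then return_pmf h else choice_kernel r \<pi> N h)" for h
  have "finite (set_pmf (K h))" for h
    unfolding K_def using finite_choice_kernel by simp
  then have "measure_pmf.expectation (choice_process r \<pi> N (Suc t)) (\<lambda>h. \<Phi> (state h)) =
    measure_pmf.expectation (choice_process r \<pi> N t)
      (\<lambda>h. measure_pmf.expectation (K h) (\<lambda>h. \<Phi> (state h)))"
    unfolding choice_process_Suc K_def[symmetric] using choice_process_support
    by (intro expectation_bind_finite) auto
  also have "(\<lambda>h. measure_pmf.expectation (K h) (\<lambda>h. \<Phi> (state h))) =
      (\<lambda>h. if {..<N} - state h = {} then \<Phi> (state h) else choice_step r \<pi> N \<Phi> h)"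
    unfolding K_def using expectation_choice_kernel by (simp add: fun_eq_iff)
  finally show ?thesis .
qed

end

lemma choice_process_potential_le:
  fixes \<Phi> :: "nat \<Rightarrow> nat set \<Rightarrow> real"
  assumes pol: "valid_policy \<pi>" "r \<ge> 1"
    and stop: "\<And>s. \<Phi> s {..<N} \<le> \<Phi> (Suc s) {..<N}"
    and step: "\<And>s h. state h \<subset> {..<N} \<Longrightarrow> choice_step r \<pi> N (\<Phi> s) h \<le> \<Phi> (Suc s) (state h)"
  shows "measure_pmf.expectation (choice_process r \<pi> N t) (\<lambda>h. \<Phi> s (state h)) \<le> \<Phi> (s + t) {}"
proof (induction t arbitrary: s)
  case (Suc t)
  have "measure_pmf.expectation (choice_process r \<pi> N (Suc t)) (\<lambda>h. \<Phi> s (state h)) =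
      measure_pmf.expectation (choice_process r \<pi> N t)
      (\<lambda>h. if {..<N} - state h = {} then \<Phi> s (state h) else choice_step r \<pi> N (\<Phi> s) h)"
    by (rule expectation_choice_process_Suc[OF pol])
  also have "\<dots> \<le> measure_pmf.expectation (choice_process r \<pi> N t) (\<lambda>h. \<Phi> (Suc s) (state h))"
  proof (rule integral_mono_AE)
    have fin: "finite (set_pmf (choice_process r \<pi> N t))"
      using choice_process_support[OF pol] by blast
    show "integrable (choice_process r \<pi> N t)
        (\<lambda>h. if {..<N} - state h = {} then \<Phi> s (state h) else choice_step r \<pi> N (\<Phi> s) h)"
      "integrable (choice_process r \<pi> N t) (\<lambda>h. \<Phi> (Suc s) (state h))"
      using fin by (rule integrable_measure_pmf_finite)+
    have "(if {..<N} - state h = {} then \<Phi> s (state h) else choice_step r \<pi> N (\<Phi> s) h)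
        \<le> \<Phi> (Suc s) (state h)" if "state h \<subseteq> {..<N}" for h
    proof (cases "{..<N} - state h = {}")
      case True
      then have "state h = {..<N}" using that by blast
      then show ?thesis using stop by simp
    next
      case False
      then have "state h \<subset> {..<N}" using that by blast
      then show ?thesis using step False by presburger
    qed
    then show "AE h in choice_process r \<pi> N t.
        (if {..<N} - state h = {} then \<Phi> s (state h) else choice_step r \<pi> N (\<Phi> s) h)
        \<le> \<Phi> (Suc s) (state h)"
      using choice_process_support[OF pol, of N t] by (subst AE_measure_pmf_iff) blast
  qed
  also have "\<dots> \<le> \<Phi> (Suc s + t) {}" by (rule Suc.IH)
  finally show ?case by simp
qed (simp add: state_Nil)

lemma choice_process_potential_ge:
  fixes \<Phi> :: "nat \<Rightarrow> nat set \<Rightarrow> real"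
  assumes pol: "valid_policy \<pi>" "r \<ge> 1"
    and stop: "\<And>s. \<Phi> (Suc s) {..<N} \<le> \<Phi> s {..<N}"
    and step: "\<And>s h. state h \<subset> {..<N} \<Longrightarrow> \<Phi> (Suc s) (state h) \<le> choice_step r \<pi> N (\<Phi> s) h"
  shows "\<Phi> (s + t) {} \<le> measure_pmf.expectation (choice_process r \<pi> N t) (\<lambda>h. \<Phi> s (state h))"
proof -
  have "measure_pmf.expectation (choice_process r \<pi> N t) (\<lambda>h. - \<Phi> s (state h)) \<le> - \<Phi> (s + t) {}"
  proof (rule choice_process_potential_le[where \<Phi> = "\<lambda>s X. - \<Phi> s X" and s = s and t = t])
    fix s h assume "state h \<subset> {..<N}"
    moreover have "choice_step r \<pi> N (\<lambda>X. - \<Phi> s X) h = - choice_step r \<pi> N (\<Phi> s) h"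
      unfolding choice_step_def Bochner_Integration.integral_minus sum_negf by simp
    ultimately show "choice_step r \<pi> N (\<lambda>X. - \<Phi> s X) h \<le> - \<Phi> (Suc s) (state h)"
      using step by simp
  qed (use pol stop in simp_all)
  then show ?thesis by simp
qed

text \<open>With \<open>s\<close> steps left the potential is the success probability of
  \<open>r * s\<close> walk steps. It dominates a choice step because, by monotonicity, adding the
  whole proposal is at least as good as adding one member of it.\<close>

lemma prob_choice_process_le:
  assumes pol: "valid_policy \<pi>" "r \<ge> 1"
    and mono: "mono_on (Pow {..<N}) (\<lambda>x. of_bool (g x) :: real)"
  shows "measure_pmf.prob (choice_process r \<pi> N t) {h. g (state h)}
    \<le> walk_avg {..<N} (r * t) (\<lambda>x. of_bool (g x)) {}"
proof -
  let ?V = "{..<N}"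
  define G where "G = (\<lambda>x. of_bool (g x) :: real)"
  define \<Phi> where "\<Phi> s = walk_avg ?V (r * s) G" for s
  have monoG: "mono_on (Pow ?V) G" using mono by (simp add: G_def)
  have mono\<Phi>: "mono_on (Pow ?V) (\<Phi> s)" for s
    unfolding \<Phi>_def using monoG by (intro mono_on_walk_avg) auto
  have "choice_step r \<pi> N (\<Phi> s) h \<le> \<Phi> (Suc s) (state h)" if sub: "state h \<subset> ?V" for s h
  proof -
    define Y where "Y = state h"
    define Z where "Z = ?V - Y"
    have Y: "Y \<subseteq> ?V" and Z: "finite Z" "Z \<noteq> {}" using sub by (auto simp: Y_def Z_def)
    have "measure_pmf.expectation (\<pi> h S) (\<lambda>i. \<Phi> s (insert i Y)) \<le> \<Phi> s (Y \<union> S)"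
      if "S \<in> proposals r Z" for S
    proof -
      note S = proposalsD[OF that Z assms(2)]
      then have p: "set_pmf (\<pi> h S) \<subseteq> S" using assms(1) by (auto simp: valid_policy_def)
      then have fin: "finite (set_pmf (\<pi> h S))" using S(2) finite_subset by auto
      have "measure_pmf.expectation (\<pi> h S) (\<lambda>i. \<Phi> s (insert i Y)) \<le>
          measure_pmf.expectation (\<pi> h S) (\<lambda>i. \<Phi> s (Y \<union> S))"
      proof (rule integral_mono_AE)
        show "AE i in \<pi> h S. \<Phi> s (insert i Y) \<le> \<Phi> s (Y \<union> S)"
          using p S Y by (auto simp: AE_measure_pmf_iff Z_def intro!: mono_on_PowD[OF mono\<Phi>])
      qed (use fin in \<open>auto intro: integrable_measure_pmf_finite\<close>)
      then show ?thesis by simp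
    qed
    then have "choice_step r \<pi> N (\<Phi> s) h \<le>
        (\<Sum>S\<in>proposals r Z. \<Phi> s (Y \<union> S)) / card (proposals r Z)"
      unfolding choice_step_def Y_def[symmetric] Z_def[symmetric]
      by (intro divide_right_mono sum_mono) auto
    \<comment> \<open>A uniform proposal added in full amounts to this many walk steps; if fewer
      than \<open>r\<close> zeros remain, padding up to \<open>r\<close> steps does no harm.\<close>
    also have "\<dots> = walk_avg ?V (min r (card Z)) (\<Phi> s) Y"
      using walk_avg_eq_subset_avg[of ?V Y "min r (card Z)" "\<Phi> s"] Y Z(1)
      by (simp add: proposals_def n_subsets Z_def)
    also have "\<dots> \<le> walk_avg ?V r (\<Phi> s) Y"
      using Y by (intro walk_avg_mono_time mono\<Phi>) auto
    also have "\<dots> = \<Phi> (Suc s) Y"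
      by (simp add: \<Phi>_def funpow_add)
    finally show ?thesis by (simp add: Y_def)
  qed
  note step = this
  have "\<Phi> s ?V \<le> \<Phi> (Suc s) ?V" for s
    unfolding \<Phi>_def by (simp add: walk_avg_full)
  with pol step have "measure_pmf.expectation (choice_process r \<pi> N t) (\<lambda>h. \<Phi> 0 (state h)) \<le> \<Phi> (0 + t) {}"
    by (intro choice_process_potential_le[where \<Phi> = \<Phi> and s = 0 and t = t])
  moreover have "measure_pmf.expectation (choice_process r \<pi> N t) (\<lambda>h. \<Phi> 0 (state h)) =
      measure_pmf.expectation (choice_process r \<pi> N t) (indicator {h. g (state h)})"
  proof -
    have "(\<lambda>h. \<Phi> 0 (state h)) = indicator {h. g (state h)}"
      by (simp add: fun_eq_iff \<Phi>_def G_def indicator_def of_bool_def)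
    then show ?thesis by (rule arg_cong)
  qed
  ultimately show ?thesis by (simp add: \<Phi>_def G_def)
qed

section \<open>Product measures and slices\<close>

text \<open>The product measure: the expectation of \<open>g\<close> at a random set containing each
  element of \<open>V\<close> independently with probability \<open>p\<close>.\<close>

definition biased :: "'a set \<Rightarrow> real \<Rightarrow> ('a set \<Rightarrow> real) \<Rightarrow> real" where
  "biased V p g = (\<Sum>X\<in>Pow V. p ^ card X * (1 - p) ^ card (V - X) * g X)"

lemma biased_empty [simp]: "biased {} p g = g {}"
  by (simp add: biased_def)

lemma biased_insert:
  assumes "finite V" "v \<notin> V"
  shows "biased (insert v V) p g = (1 - p) * biased V p g + p * biased V p (\<lambda>X. g (insert v X))"
proof -
  have inj: "inj_on (insert v) (Pow V)"
    using assms(2) by (auto simp: inj_on_def)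
  let ?w = "\<lambda>X. p ^ card X * (1 - p) ^ card (insert v V - X) * g X"
  have "biased (insert v V) p g = sum ?w (Pow V) + sum ?w (insert v ` Pow V)"
    unfolding biased_def Pow_insert using assms by (intro sum.union_disjoint) auto
  also have "sum ?w (Pow V) = (\<Sum>X\<in>Pow V. (1 - p) * (p ^ card X * (1 - p) ^ card (V - X) * g X))"
  proof (intro sum.cong refl)
    fix X assume "X \<in> Pow V"
    then have "v \<notin> X" "finite (V - X)" "v \<notin> V - X" using assms by auto
    then show "?w X = (1 - p) * (p ^ card X * (1 - p) ^ card (V - X) * g X)"
      by (simp add: insert_Diff_if)
  qed
  also have "sum ?w (insert v ` Pow V) =
      (\<Sum>X\<in>Pow V. p * (p ^ card X * (1 - p) ^ card (V - X) * g (insert v X)))"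
    unfolding sum.reindex[OF inj] o_def
  proof (intro sum.cong refl)
    fix X assume "X \<in> Pow V"
    then have "v \<notin> X" "finite X" "insert v V - insert v X = V - X"
      using assms by (auto intro: finite_subset)
    then show "?w (insert v X) = p * (p ^ card X * (1 - p) ^ card (V - X) * g (insert v X))"
      by simp
  qed
  finally show ?thesis by (simp add: biased_def sum_distrib_left)
qed

lemma biased_cong: "(\<And>X. X \<subseteq> V \<Longrightarrow> g X = h X) \<Longrightarrow> biased V p g = biased V p h"
  unfolding biased_def by (intro sum.cong) auto

lemma biased_mono:
  assumes "0 \<le> p" "p \<le> 1" "\<And>X. X \<subseteq> V \<Longrightarrow> g X \<le> h X"
  shows "biased V p g \<le> biased V p h"
  unfolding biased_def using assms by (intro sum_mono mult_left_mono) auto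

lemma biased_const: "finite V \<Longrightarrow> biased V p (\<lambda>_. c) = c"
  by (induction V rule: finite_induct) (auto simp: biased_insert algebra_simps)

lemma biased_diff: "biased V p (\<lambda>X. g X - h X) = biased V p g - biased V p h"
  by (simp add: biased_def algebra_simps sum_subtractf)

lemma biased_0: "finite V \<Longrightarrow> biased V 0 g = g {}"
  by (induction V arbitrary: g rule: finite_induct) (auto simp: biased_insert)

lemma biased_1: "finite V \<Longrightarrow> biased V 1 g = g V"
  by (induction V arbitrary: g rule: finite_induct) (auto simp: biased_insert)

text \<open>Coordinates outside \<open>R\<close> are added one at a time, and both terms of
  \<open>biased_insert\<close> coincide for each. Hence one threshold bias serves both
  \<open>R\<close> and \<open>V\<close>.\<close>

lemma biased_restrict:
  assumes "finite V" "R \<subseteq> V" "\<And>X. X \<subseteq> V \<Longrightarrow> g X = g (X \<inter> R)"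
  shows "biased V p g = biased R p g"
proof -
  have "biased (R \<union> D) p (\<lambda>X. g (X \<inter> R)) = biased R p (\<lambda>X. g (X \<inter> R))"
    if "finite D" "D \<inter> R = {}" for D
    using that
  proof (induction D rule: finite_induct)
    case (insert v D)
    then have "insert v X \<inter> R = X \<inter> R" for X by auto
    moreover have "finite (R \<union> D)" "v \<notin> R \<union> D"
      using insert finite_subset[OF assms(2,1)] by auto
    ultimately show ?case
      using insert by (simp add: biased_insert algebra_simps)
  qed simp
  from this[of "V - R"] have "biased V p (\<lambda>X. g (X \<inter> R)) = biased R p (\<lambda>X. g (X \<inter> R))"
    using assms(1,2) by (simp add: Un_absorb1 inf_commute)
  moreover have "biased V p g = biased V p (\<lambda>X. g (X \<inter> R))"
    using assms(3) by (intro biased_cong)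
  moreover have "biased R p g = biased R p (\<lambda>X. g (X \<inter> R))"
    using assms(2) by (intro biased_cong) (simp add: Int_absorb2)
  ultimately show ?thesis by simp
qed

lemma biased_eq_half_ex:
  assumes "finite V" "g {} = 0" "g V = 1"
  obtains p where "0 \<le> p" "p \<le> 1" "biased V p g = 1/2"
proof -
  have "\<exists>p\<ge>0. p \<le> 1 \<and> biased V p g = 1/2"
    using assms by (intro IVT') (auto simp: biased_0 biased_1, auto simp: biased_def intro!: continuous_on_sum continuous_on_mult continuous_on_power
        continuous_on_diff continuous_on_id continuous_on_const)
  then show ?thesis using that by auto
qed

section \<open>The power inequality for decreasing functions\<close>

text \<open>Convexity of the power function: the derivative of the right-hand side in the shift
  \<open>c\<close> is nonnegative.\<close>

lemma powr_diff_mono: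
  fixes x y c \<alpha> :: real
  assumes "0 \<le> x" "x \<le> y" "0 \<le> c" "1 \<le> \<alpha>"
  shows "y powr \<alpha> - x powr \<alpha> \<le> (y + c) powr \<alpha> - (x + c) powr \<alpha>"
proof -
  let ?h = "\<lambda>c. (y + c) powr \<alpha> - (x + c) powr \<alpha>"
  have "?h 0 \<le> ?h c"
  proof (rule DERIV_nonneg_imp_increasing_open[OF assms(3)])
    fix t :: real assume t: "0 < t" "t < c"
    have "(?h has_real_derivative \<alpha> * (y + t) powr (\<alpha> - 1) - \<alpha> * (x + t) powr (\<alpha> - 1)) (at t)"
      using t assms by (auto intro!: derivative_eq_intros)
    moreover have "(x + t) powr (\<alpha> - 1) \<le> (y + t) powr (\<alpha> - 1)"
      using t assms by (intro powr_mono2) auto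
    then have "\<alpha> * (y + t) powr (\<alpha> - 1) - \<alpha> * (x + t) powr (\<alpha> - 1) \<ge> 0"
      using assms by (simp add: mult_left_mono)
    ultimately show "\<exists>z. (?h has_real_derivative z) (at t) \<and> 0 \<le> z" by blast
  next
    show "continuous_on {0..c} ?h"
      using assms by (intro continuous_intros continuous_on_powr') auto
  qed
  then show ?thesis by simp
qed

text \<open>The one-coordinate case of \<open>biased_powr_le\<close>, from
  \<open>powr_diff_mono\<close> at the points \<open>q * b\<close> and \<open>q * a\<close> with
  shift \<open>(1 - q) * b\<close>.\<close>

lemma two_point_powr:
  fixes a b q \<alpha> :: real
  assumes "0 \<le> b" "b \<le> a" "0 \<le> q" "q \<le> 1" "1 \<le> \<alpha>"
  shows "q powr \<alpha> * a powr \<alpha> + (1 - q powr \<alpha>) * b powr \<alpha> \<le> (q * a + (1 - q) * b) powr \<alpha>"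
proof -
  have "(q * a) powr \<alpha> - (q * b) powr \<alpha> \<le>
      (q * a + (1 - q) * b) powr \<alpha> - (q * b + (1 - q) * b) powr \<alpha>"
    using assms by (intro powr_diff_mono mult_left_mono) auto
  also have "q * b + (1 - q) * b = b" by (simp add: algebra_simps)
  finally show ?thesis using assms by (simp add: powr_mult algebra_simps)
qed

text \<open>Induction on the dimension. With \<open>q = 1 - p\<close>, a coordinate is absent at the
  new bias with probability \<open>q powr \<alpha>\<close>, exactly the weight in
  \<open>two_point_powr\<close>. There \<open>?a\<close> and \<open>?b\<close> are the averages of
  \<open>d\<close> with \<open>v\<close> absent and present, and \<open>?b \<le> ?a\<close> because
  \<open>d\<close> is decreasing.\<close>

lemma biased_powr_le:
  assumes "finite V" "0 \<le> p" "p \<le> 1" "1 \<le> \<alpha>"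
    and "\<And>X. X \<subseteq> V \<Longrightarrow> 0 \<le> d X"
    and "\<And>X Y. X \<subseteq> Y \<Longrightarrow> Y \<subseteq> V \<Longrightarrow> d Y \<le> d X"
  shows "biased V (1 - (1 - p) powr \<alpha>) (\<lambda>X. d X powr \<alpha>) \<le> biased V p d powr \<alpha>"
  using assms(1,5,6)
proof (induction V arbitrary: d rule: finite_induct)
  case (insert v V)
  define q where "q = 1 - p"
  have q: "0 \<le> q" "q \<le> 1" and p: "p = 1 - q" using assms by (auto simp: q_def)
  let ?a = "biased V p d" and ?b = "biased V p (\<lambda>X. d (insert v X))"
  have "biased V p (\<lambda>_. 0) \<le> ?b"
    using assms(2,3) by (intro biased_mono insert.prems(1)) auto
  then have b: "0 \<le> ?b" using insert.hyps by (simp add: biased_const)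
  have ab: "?b \<le> ?a"
    using assms(2,3) by (intro biased_mono insert.prems(2)) auto
  have q': "q powr \<alpha> \<le> 1" using q assms(4) by (simp add: powr_le1)
  have "biased (insert v V) (1 - q powr \<alpha>) (\<lambda>X. d X powr \<alpha>) =
      q powr \<alpha> * biased V (1 - q powr \<alpha>) (\<lambda>X. d X powr \<alpha>) +
      (1 - q powr \<alpha>) * biased V (1 - q powr \<alpha>) (\<lambda>X. d (insert v X) powr \<alpha>)"
    using insert.hyps by (simp add: biased_insert)
  also have "\<dots> \<le> q powr \<alpha> * ?a powr \<alpha> + (1 - q powr \<alpha>) * ?b powr \<alpha>"
    unfolding q_def
    by (intro add_mono mult_left_mono insert.IH insert.prems)
      (use q' insert.prems in \<open>auto simp: q_def\<close>)
  also have "\<dots> \<le> (q * ?a + (1 - q) * ?b) powr \<alpha>"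
    using b ab q assms(4) by (intro two_point_powr)
  also have "q * ?a + (1 - q) * ?b = biased (insert v V) p d"
    using insert.hyps by (simp add: biased_insert q_def)
  finally show ?case unfolding q_def .
qed simp

text \<open>Young's inequality with weights \<open>1/\<alpha>\<close> and
  \<open>1 - 1/\<alpha>\<close> for the numbers \<open>(1 - p) powr \<alpha>\<close> and 1. The case
  \<open>p = 1\<close>, where the first number is 0, is direct.\<close>

lemma Bernoulli_powr:
  fixes p \<alpha> :: real
  assumes "0 \<le> p" "p \<le> 1" "1 \<le> \<alpha>"
  shows "1 - \<alpha> * p \<le> (1 - p) powr \<alpha>"
proof (cases "p = 1")
  case False
  have "((1 - p) powr \<alpha>) powr (1/\<alpha>) * 1 powr (1 - 1/\<alpha>) \<le> (1/\<alpha>) * (1 - p) powr \<alpha> + (1 - 1/\<alpha>) * 1"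
    using assms False by (intro Youngs_inequality_0) auto
  then have "1 - p \<le> (1/\<alpha>) * (1 - p) powr \<alpha> + (1 - 1/\<alpha>)"
    using assms by (simp add: powr_powr)
  then have "\<alpha> * (1 - p) \<le> \<alpha> * ((1/\<alpha>) * (1 - p) powr \<alpha> + (1 - 1/\<alpha>))"
    using assms by (intro mult_left_mono) auto
  also have "\<dots> = (1 - p) powr \<alpha> + \<alpha> - 1"
    using assms by (simp add: field_simps)
  finally show ?thesis by (simp add: algebra_simps)
qed (use assms in simp)

section \<open>Concentration of the number of ones\<close>

text \<open>Conditioning on the number of ones, which is binomial: given its value \<open>k\<close>,
  the random set is distributed as the walk after \<open>k\<close> steps.\<close>

lemma biased_eq_Bernstein:
  assumes "finite V"
  shows "biased V p g = (\<Sum>k\<le>card V. Bernstein (card V) k p * walk_avg V k g {})"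
proof -
  have "biased V p g = (\<Sum>k\<le>card V. \<Sum>X\<in>{X \<in> Pow V. card X = k}. p ^ card X * (1 - p) ^ card (V - X) * g X)"
    unfolding biased_def using assms
    by (intro sum.group[symmetric]) (auto intro: card_mono)
  also have "\<dots> = (\<Sum>k\<le>card V. Bernstein (card V) k p * walk_avg V k g {})"
  proof (intro sum.cong refl)
    fix k assume "k \<in> {..card V}"
    then have k: "k \<le> card V" by simp
    have "(\<Sum>X\<in>{X \<in> Pow V. card X = k}. p ^ card X * (1 - p) ^ card (V - X) * g X) =
        (\<Sum>X\<in>{X. X \<subseteq> V \<and> card X = k}. p ^ k * (1 - p) ^ (card V - k) * g X)"
      using assms by (intro sum.cong) (auto simp: card_Diff_subset finite_subset)
    also have "\<dots> = p ^ k * (1 - p) ^ (card V - k) * (\<Sum>X\<in>{X. X \<subseteq> V \<and> card X = k}. g X)"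
      by (simp add: sum_distrib_left)
    also have "(\<Sum>X\<in>{X. X \<subseteq> V \<and> card X = k}. g X) = (card V choose k) * walk_avg V k g {}"
      using walk_avg_eq_subset_avg[OF assms, of "{}" k g] k by simp
    finally show "(\<Sum>X\<in>{X \<in> Pow V. card X = k}. p ^ card X * (1 - p) ^ card (V - X) * g X) =
        Bernstein (card V) k p * walk_avg V k g {}"
      by (simp add: Bernstein_def)
  qed
  finally show ?thesis .
qed

text \<open>The binomial variance: expressing the square through \<open>k * (k - 1)\<close>,
  \<open>k\<close> and 1 leaves three known sums.\<close>

lemma Bernstein_variance:
  "(\<Sum>k\<le>n. Bernstein n k p * (real k - n * p)\<^sup>2) = n * p * (1 - p)"
proof -
  have "(\<Sum>k\<le>n. Bernstein n k p * (real k - n * p)\<^sup>2) =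
    (\<Sum>k\<le>n. real k * (real k - 1) * Bernstein n k p + (1 - 2 * n * p) * (real k * Bernstein n k p)
       + (n * p)\<^sup>2 * Bernstein n k p)"
    by (intro sum.cong) (auto simp: algebra_simps power2_eq_square)
  also have "\<dots> = n * (real n - 1) * p\<^sup>2 + (1 - 2 * n * p) * (n * p) + (n * p)\<^sup>2"
    by (simp only: sum.distrib sum_distrib_left[symmetric] sum_k_Bernstein sum_kk_Bernstein sum_Bernstein)
  also have "\<dots> = n * p * (1 - p)"
    by (simp add: algebra_simps power2_eq_square)
  finally show ?thesis .
qed

text \<open>Chebyshev's inequality: the quadratic term absorbs those \<open>k\<close> for which
  \<open>\<phi> k \<le> \<psi> k\<close> fails.\<close>

lemma sum_Bernstein_le:
  assumes p: "0 \<le> p" "p \<le> 1" and c: "c > 0"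
    and le: "\<And>k. k \<le> n \<Longrightarrow> \<phi> k \<le> \<psi> k + (real k - n * p)\<^sup>2 / c\<^sup>2"
  shows "(\<Sum>k\<le>n. Bernstein n k p * \<phi> k) \<le> (\<Sum>k\<le>n. Bernstein n k p * \<psi> k) + n * p / c\<^sup>2"
proof -
  have "(\<Sum>k\<le>n. Bernstein n k p * \<phi> k) \<le>
      (\<Sum>k\<le>n. Bernstein n k p * (\<psi> k + (real k - n * p)\<^sup>2 / c\<^sup>2))"
    using p le by (intro sum_mono mult_left_mono) (auto simp: Bernstein_nonneg)
  also have "\<dots> = (\<Sum>k\<le>n. Bernstein n k p * \<psi> k) + (\<Sum>k\<le>n. Bernstein n k p * (real k - n * p)\<^sup>2) / c\<^sup>2"
    by (simp add: distrib_left sum.distrib sum_divide_distrib)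
  also have "(\<Sum>k\<le>n. Bernstein n k p * (real k - n * p)\<^sup>2) / c\<^sup>2 \<le> n * p / c\<^sup>2"
    unfolding Bernstein_variance using p by (intro divide_right_mono) (auto intro: mult_left_le)
  finally show ?thesis by simp
qed

context
  fixes V :: "'a set" and g :: "'a set \<Rightarrow> real" and p :: real
  assumes fin: "finite V" and mono: "mono_on (Pow V) g"
    and g01: "\<And>X. 0 \<le> g X" "\<And>X. g X \<le> 1" and p: "0 \<le> p" "p \<le> 1"
begin

text \<open>Sizes \<open>k \<le> a\<close> are covered by monotonicity in time. For
  \<open>k > a\<close> the quadratic term is at least 1, while all averages lie between 0 and
  1.\<close>

lemma biased_le_walk_avg:
  assumes "card V * p < a"
  shows "biased V p g \<le> walk_avg V a g {} + card V * p / (a - card V * p)\<^sup>2"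
proof -
  let ?n = "card V"
  have "(\<Sum>k\<le>?n. Bernstein ?n k p * walk_avg V k g {}) \<le>
      (\<Sum>k\<le>?n. Bernstein ?n k p * walk_avg V a g {}) + ?n * p / (a - ?n * p)\<^sup>2"
  proof (rule sum_Bernstein_le[OF p])
    fix k
    show "walk_avg V k g {} \<le> walk_avg V a g {} + (real k - ?n * p)\<^sup>2 / (a - ?n * p)\<^sup>2"
    proof (cases "k \<le> a")
      case True
      then have "walk_avg V k g {} \<le> walk_avg V a g {}"
        by (intro walk_avg_mono_time fin mono) auto
      then show ?thesis by (smt (verit) zero_le_divide_iff zero_le_power2)
    next
      case False
      then have "(a - ?n * p)\<^sup>2 \<le> (real k - ?n * p)\<^sup>2"
        using assms by (intro power_mono) auto
      then have "1 \<le> (real k - ?n * p)\<^sup>2 / (a - ?n * p)\<^sup>2"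
        using assms by simp
      moreover have "walk_avg V k g {} \<le> 1" "0 \<le> walk_avg V a g {}"
        using fin g01 by (auto intro: walk_avg_le_1 walk_avg_ge_0)
      ultimately show ?thesis by simp
    qed
  qed (use assms in auto)
  then show ?thesis
    by (simp add: biased_eq_Bernstein[OF fin] sum_distrib_right[symmetric])
qed

text \<open>The mirror image: now the quadratic term pays for sizes below \<open>s\<close>.\<close>

lemma walk_avg_le_biased:
  assumes "real s < card V * p"
  shows "walk_avg V s g {} \<le> biased V p g + card V * p / (card V * p - s)\<^sup>2"
proof -
  let ?n = "card V"
  have "(\<Sum>k\<le>?n. Bernstein ?n k p * walk_avg V s g {}) \<le>
      (\<Sum>k\<le>?n. Bernstein ?n k p * walk_avg V k g {}) + ?n * p / (?n * p - s)\<^sup>2"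
  proof (rule sum_Bernstein_le[OF p])
    fix k
    show "walk_avg V s g {} \<le> walk_avg V k g {} + (real k - ?n * p)\<^sup>2 / (?n * p - s)\<^sup>2"
    proof (cases "s \<le> k")
      case True
      then have "walk_avg V s g {} \<le> walk_avg V k g {}"
        by (intro walk_avg_mono_time fin mono) auto
      then show ?thesis by (smt (verit) zero_le_divide_iff zero_le_power2)
    next
      case False
      then have "(?n * p - s)\<^sup>2 \<le> (?n * p - real k)\<^sup>2"
        using assms by (intro power_mono) auto
      then have "1 \<le> (real k - ?n * p)\<^sup>2 / (?n * p - s)\<^sup>2"
        using assms by (simp add: power2_commute)
      moreover have "walk_avg V s g {} \<le> 1" "0 \<le> walk_avg V k g {}"
        using fin g01 by (auto intro: walk_avg_le_1 walk_avg_ge_0)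
      ultimately show ?thesis by simp
    qed
  qed (use assms in auto)
  then show ?thesis
    by (simp add: biased_eq_Bernstein[OF fin] sum_distrib_right[symmetric])
qed

end

section \<open>The walk a constant factor away from its threshold\<close>

context
  fixes V :: "'a set" and f :: "'a set \<Rightarrow> bool" and p \<alpha> :: real
  assumes fin: "finite V" and mono: "mono_on (Pow V) (\<lambda>X. of_bool (f X) :: real)"
    and p: "0 \<le> p" "p \<le> 1" and half: "biased V p (\<lambda>X. of_bool (f X)) = 1/2"
    and \<alpha>: "1 < \<alpha>"
begin

lemma compl_antimono:
  assumes "X \<subseteq> Y" "Y \<subseteq> V"
  shows "1 - of_bool (f Y) \<le> (1 - of_bool (f X) :: real)"
  using mono_on_PowD[OF mono assms] by simp

text \<open>Powers do not change the values 0 and 1, so \<open>biased_powr_le\<close> becomes a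
  statement about the probability of \<open>f = 0\<close>.\<close>

lemma compl_powr: "\<beta> > 0 \<Longrightarrow> (1 - of_bool (f X)) powr \<beta> = (1 - of_bool (f X) :: real)"
  by simp

lemma biased_compl: "biased V q (\<lambda>X. 1 - of_bool (f X)) = 1 - biased V q (\<lambda>X. of_bool (f X))"
  by (simp add: biased_diff biased_const fin)

lemma biased_boost:
  "1 - 2 powr (-\<alpha>) \<le> biased V (1 - (1 - p) powr \<alpha>) (\<lambda>X. of_bool (f X))"
proof -
  have "biased V (1 - (1 - p) powr \<alpha>) (\<lambda>X. (1 - of_bool (f X)) powr \<alpha>) \<le>
      biased V p (\<lambda>X. 1 - of_bool (f X)) powr \<alpha>"
    using fin p \<alpha> compl_antimono by (intro biased_powr_le) auto
  then have "1 - biased V (1 - (1 - p) powr \<alpha>) (\<lambda>X. of_bool (f X)) \<le> (1/2) powr \<alpha>"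
    using \<alpha> by (simp add: compl_powr biased_compl half del: of_bool_eq)
  then show ?thesis by (simp add: powr_divide powr_minus_divide)
qed

text \<open>The power inequality read downwards: the exponent \<open>\<alpha>\<close> lifts the bias
  \<open>q\<close> to \<open>p\<close>, so 1/2 is at most the \<open>\<alpha>\<close>-th power of
  the probability of \<open>f = 0\<close> at bias \<open>q\<close>. Taking roots gives the
  claim.\<close>

lemma biased_damp:
  "biased V (1 - (1 - p) powr (1/\<alpha>)) (\<lambda>X. of_bool (f X)) \<le> 1 - 2 powr (-1/\<alpha>)"
proof -
  define q where "q = 1 - (1 - p) powr (1/\<alpha>)"
  have q: "0 \<le> q" "q \<le> 1" using p \<alpha> by (auto simp: q_def powr_le1)
  have "1 - (1 - q) powr \<alpha> = p" using p \<alpha> by (simp add: q_def powr_powr)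
  moreover have "biased V (1 - (1 - q) powr \<alpha>) (\<lambda>X. (1 - of_bool (f X)) powr \<alpha>) \<le>
      biased V q (\<lambda>X. 1 - of_bool (f X)) powr \<alpha>"
    using fin q \<alpha> compl_antimono by (intro biased_powr_le) auto
  ultimately have le: "1/2 \<le> (1 - biased V q (\<lambda>X. of_bool (f X))) powr \<alpha>"
    using \<alpha> by (simp add: compl_powr biased_compl half del: of_bool_eq)
  have "biased V q (\<lambda>X. of_bool (f X)) \<le> biased V q (\<lambda>_. 1)"
    using q by (intro biased_mono) auto
  then have "0 \<le> 1 - biased V q (\<lambda>X. of_bool (f X))"
    using fin by (simp add: biased_const)
  then have "1 - biased V q (\<lambda>X. of_bool (f X)) =
      ((1 - biased V q (\<lambda>X. of_bool (f X))) powr \<alpha>) powr (1/\<alpha>)"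
    using \<alpha> by (simp add: powr_powr)
  also have "\<dots> \<ge> (1/2) powr (1/\<alpha>)"
    using le \<alpha> by (intro powr_mono2) auto
  also have "(1/2) powr (1/\<alpha>) = 2 powr (-1/\<alpha>)"
    using powr_minus_divide[of 2 "1/\<alpha>"] by (simp add: powr_divide)
  finally show ?thesis by (simp add: q_def)
qed

text \<open>By Bernoulli the boosted bias is at most \<open>\<alpha> * p\<close>, so
  \<open>a\<close> still exceeds the mean size and \<open>biased_boost\<close> transfers to the walk
  with a Chebyshev loss.\<close>

lemma walk_avg_boost:
  assumes a: "\<alpha> * (card V * p) < a"
  shows "1 - 2 powr (-\<alpha>) - \<alpha> * (card V * p) / (a - \<alpha> * (card V * p))\<^sup>2
    \<le> walk_avg V a (\<lambda>X. of_bool (f X)) {}"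
proof -
  define q where "q = 1 - (1 - p) powr \<alpha>"
  have q: "0 \<le> q" "q \<le> 1" "q \<le> \<alpha> * p"
    using p \<alpha> Bernoulli_powr[OF p, of \<alpha>] by (auto simp: q_def powr_le1)
  then have le: "card V * q \<le> \<alpha> * (card V * p)"
    using mult_left_mono[OF q(3), of "card V"] by (simp add: mult_ac)
  have "biased V q (\<lambda>X. of_bool (f X)) \<le>
      walk_avg V a (\<lambda>X. of_bool (f X)) {} + card V * q / (a - card V * q)\<^sup>2"
    using a le q by (intro biased_le_walk_avg fin mono) auto
  moreover have "card V * q / (a - card V * q)\<^sup>2 \<le> \<alpha> * (card V * p) / (a - \<alpha> * (card V * p))\<^sup>2"
    using a le p \<alpha> by (intro frac_le power_mono) auto
  ultimately show ?thesis using biased_boost by (simp add: q_def)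
qed

lemma walk_avg_damp:
  assumes s: "real s < card V * p / \<alpha>"
  shows "walk_avg V s (\<lambda>X. of_bool (f X)) {} \<le>
    1 - 2 powr (-1/\<alpha>) + card V * p / (card V * p / \<alpha> - s)\<^sup>2"
proof -
  define q where "q = 1 - (1 - p) powr (1/\<alpha>)"
  \<comment> \<open>Bernoulli at \<open>p/\<alpha>\<close> and an \<open>\<alpha>\<close>-th root
    bound \<open>q\<close> from below, which keeps the mean size above \<open>s\<close>. The bound
    \<open>q \<le> p\<close> further down controls the variance.\<close>
  have "1 - p \<le> (1 - p/\<alpha>) powr \<alpha>"
    using Bernoulli_powr[of "p/\<alpha>" \<alpha>] p \<alpha> by (simp add: divide_le_eq)
  then have "(1 - p) powr (1/\<alpha>) \<le> ((1 - p/\<alpha>) powr \<alpha>) powr (1/\<alpha>)"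
    using p \<alpha> by (intro powr_mono2) auto
  also have "\<dots> = 1 - p/\<alpha>"
    using p \<alpha> by (simp add: powr_powr divide_le_eq)
  finally have q1: "p / \<alpha> \<le> q" by (simp add: q_def)
  have "(1 - p) powr 1 \<le> (1 - p) powr (1/\<alpha>)"
    using p \<alpha> by (intro powr_mono') auto
  then have q2: "q \<le> p" using p by (simp add: q_def)
  have q: "0 \<le> q" "q \<le> 1" using p \<alpha> by (auto simp: q_def powr_le1)
  have le: "card V * p / \<alpha> \<le> card V * q"
    using mult_left_mono[OF q1, of "card V"] by simp
  have "walk_avg V s (\<lambda>X. of_bool (f X)) {} \<le>
      biased V q (\<lambda>X. of_bool (f X)) + card V * q / (card V * q - s)\<^sup>2"
    using s le q by (intro walk_avg_le_biased fin mono) auto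
  moreover have "card V * q / (card V * q - s)\<^sup>2 \<le> card V * p / (card V * p / \<alpha> - s)\<^sup>2"
    using s le p q2 by (intro frac_le power_mono mult_left_mono) auto
  ultimately show ?thesis using biased_damp by (simp add: q_def)
qed

text \<open>One factor \<open>\<alpha>\<close> pays for the changed bias; the second leaves a gap of
  order \<open>card V * p\<close> between \<open>a\<close> and the mean, so the Chebyshev loss is of
  order \<open>1 / (card V * p)\<close>.\<close>

lemma walk_avg_ge_near_threshold:
  assumes a: "\<alpha>\<^sup>2 * (card V * p) \<le> a" and pos: "0 < card V * p"
  shows "1 - 2 powr (-\<alpha>) - 1 / (\<alpha> * (\<alpha> - 1)\<^sup>2) / (card V * p)
    \<le> walk_avg V a (\<lambda>X. of_bool (f X)) {}"
proof -
  define y where "y = card V * p"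
  have y: "y > 0" using pos by (simp add: y_def)
  have d: "\<alpha> * (\<alpha> - 1) * y \<le> a - \<alpha> * y"
    using a[folded y_def] by (simp add: power2_eq_square algebra_simps)
  have d0: "0 < \<alpha> * (\<alpha> - 1) * y" using \<alpha> y by simp
  have "\<alpha> * y / (a - \<alpha> * y)\<^sup>2 \<le> \<alpha> * y / (\<alpha> * (\<alpha> - 1) * y)\<^sup>2"
    using d d0 \<alpha> y by (intro frac_le power_mono zero_less_power) auto
  also have "\<dots> = 1 / (\<alpha> * (\<alpha> - 1)\<^sup>2) / y"
    using \<alpha> y by (simp add: power2_eq_square)
  finally show ?thesis
    using walk_avg_boost[of a] d d0 by (simp add: y_def)
qed

lemma walk_avg_le_near_threshold:
  assumes s: "s \<le> card V * p / \<alpha>\<^sup>2" and pos: "0 < card V * p"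
  shows "walk_avg V s (\<lambda>X. of_bool (f X)) {} \<le>
    1 - 2 powr (-1/\<alpha>) + \<alpha> ^ 4 / (\<alpha> - 1)\<^sup>2 / (card V * p)"
proof -
  define y where "y = card V * p"
  have y: "y > 0" using pos by (simp add: y_def)
  have d: "(\<alpha> - 1) * y / \<alpha>\<^sup>2 \<le> y / \<alpha> - s"
    using s[folded y_def] \<alpha> by (simp add: power2_eq_square field_simps)
  have d0: "0 < (\<alpha> - 1) * y / \<alpha>\<^sup>2" using \<alpha> y by simp
  have "y / (y / \<alpha> - s)\<^sup>2 \<le> y / ((\<alpha> - 1) * y / \<alpha>\<^sup>2)\<^sup>2"
    using d d0 y by (intro frac_le power_mono zero_less_power) auto
  also have "\<dots> = \<alpha> ^ 4 / (\<alpha> - 1)\<^sup>2 / y"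
    using \<alpha> y by (simp add: power2_eq_square power4_eq_xxxx)
  finally show ?thesis
    using walk_avg_damp[of s] d d0 by (simp add: y_def)
qed

end

section \<open>A policy preferring relevant coordinates\<close>

text \<open>A uniform \<open>r\<close>-subset of \<open>z\<close> points avoids \<open>d\<close>
  marked ones with probability at most \<open>z / (z + r * d)\<close>. The induction on
  \<open>r\<close> rests on the recursion \<open>rec\<close> for both binomials.\<close>

lemma binomial_diff_le:
  assumes "d \<le> z" "r \<le> z"
  shows "real (z - d choose r) * (z + r * d) \<le> real (z choose r) * z"
  using assms(2)
proof (induction r)
  case (Suc r)
  have rec: "real (Suc k) * real (n choose Suc k) = (real n - k) * (n choose k)" if "k \<le> n" for n k :: nat
  proof -
    have "Suc k * (n choose Suc k) = (n - k) * (n choose k)"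
      by (metis binomial_absorb_comp binomial_absorption mult.commute)
    then have "real (Suc k * (n choose Suc k)) = real ((n - k) * (n choose k))" by simp
    then show ?thesis using that by (simp only: of_nat_mult of_nat_diff)
  qed
  show ?case
  proof (cases "z - d < Suc r")
    case False
    then have zd: "real (z - d) = real z - d" "real z - d - r \<ge> 0" "r \<le> z - d"
      using assms(1) by auto
    have "real (Suc r) * (real (z - d choose Suc r) * (z + Suc r * d)) =
        real (z - d choose r) * ((real z - d - r) * (z + Suc r * d))"
      using arg_cong[OF rec[OF zd(3)], of "\<lambda>x. x * real (z + Suc r * d)"]
      by (simp only: zd(1) mult_ac)
    also have "\<dots> \<le> real (z - d choose r) * ((real z - r) * (z + r * d))"
    proof (intro mult_left_mono)
      \<comment> \<open>All terms containing \<open>z\<close> cancel, which is why a bound of this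
        form survives the induction.\<close>
      have "(real z - r) * (z + r * d) - (real z - d - r) * (z + Suc r * d) = d * (r + r * d + d)"
        by (simp add: algebra_simps)
      also have "\<dots> \<ge> 0" by simp
      finally show "(real z - d - r) * (z + Suc r * d) \<le> (real z - r) * (z + r * d)"
        by simp
    qed simp
    also have "\<dots> = (real z - r) * (real (z - d choose r) * (z + r * d))"
      by simp
    also have "\<dots> \<le> (real z - r) * (real (z choose r) * z)"
      using Suc by (intro mult_left_mono) auto
    also have "\<dots> = real (Suc r) * (real (z choose Suc r) * z)"
      using arg_cong[OF rec[of r z], of "\<lambda>x. x * real z"] Suc.prems
      by (simp only: mult_ac Suc_leD)
    finally show ?thesis by (simp del: of_nat_Suc)
  qed (simp add: binomial_eq_0 del: of_nat_Suc)
qed simp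

definition hitting_proposals :: "nat \<Rightarrow> nat set \<Rightarrow> nat set \<Rightarrow> nat set set" where
  "hitting_proposals r Z D = {S \<in> proposals r Z. S \<inter> D \<noteq> {}}"

text \<open>The complement of \<open>binomial_diff_le\<close> at the actual sizes \<open>x\<close>
  and \<open>z\<close>; the resulting fraction increases in \<open>x\<close> and decreases in
  \<open>z\<close>, so it can be replaced by bounds independent of the current state.\<close>

lemma hitting_fraction_ge:
  assumes Z: "finite Z" "D \<subseteq> Z" "D \<noteq> {}" and r: "r \<ge> 1"
    and d: "d \<le> card D" and n: "card Z \<le> n"
  shows "real r * real d / (real n + real r * real d) \<le> card (hitting_proposals r Z D) / card (proposals r Z)"
proof -
  define x where "x = card D"
  define z where "z = card Z"
  define H where "H = hitting_proposals r Z D"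
  define M where "M = {S. S \<subseteq> Z - D \<and> card S = min r z}"
  have finD: "finite D" using Z finite_subset by auto
  have xz: "0 < x" "x \<le> z"
    using Z finD by (auto simp: x_def z_def card_gt_0_iff card_mono)
  have "proposals r Z = H \<union> M" "H \<inter> M = {}"
    by (auto simp: H_def M_def hitting_proposals_def proposals_def z_def)
  then have "card (proposals r Z) = card H + card M"
    using finite_proposals[OF Z(1), of r] by (metis card_Un_disjoint finite_Un)
  moreover have "card M = z - x choose min r z"
    using Z finD by (simp add: M_def n_subsets card_Diff_subset x_def z_def)
  ultimately have H: "real (card H) = card (proposals r Z) - real (z - x choose min r z)"
    by simp
  have P: "card (proposals r Z) = z choose min r z"
    using Z by (simp add: card_proposals z_def)
  have P0: "0 < real (z choose min r z)" by simp
  have le: "real (z - x choose min r z) * (z + r * x) \<le> real (z choose min r z) * z"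
  proof (cases "r \<le> z")
    case True
    then show ?thesis using binomial_diff_le[of x z r] xz by simp
  next
    \<comment> \<open>All zeros are proposed, and \<open>z - x choose z\<close> vanishes because
      \<open>x > 0\<close>.\<close>
    case False
    then show ?thesis using xz by (simp add: binomial_eq_0)
  qed
  have "real r * real d / (real n + real r * real d) \<le> r * x / (z + r * x)"
  proof -
    have "real (r * d) * z \<le> real (r * x) * n"
      using d n by (intro mult_mono) (auto simp: x_def z_def intro: mult_left_mono)
    moreover have "real z + real r * real x > 0" "real n + real r * real d > 0"
      using xz n by (auto simp: z_def intro!: add_pos_nonneg)
    ultimately show ?thesis
      by (auto simp: field_simps)
  qed
  also have "\<dots> \<le> card H / card (proposals r Z)"
  proof -
    have "real (z - x choose min r z) / (z choose min r z) \<le> z / (z + r * x)"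
      using le P0 xz by (simp add: pos_divide_le_eq pos_le_divide_eq add_pos_nonneg mult.commute)
    moreover have "r * x / (z + r * x) = 1 - z / (z + r * x)"
    proof -
      have "real z + real r * real x > 0" using xz by (intro add_pos_nonneg) auto
      then show ?thesis by (simp add: field_simps)
    qed
    ultimately show ?thesis unfolding H P by (simp add: diff_divide_distrib)
  qed
  finally show ?thesis by (simp add: H_def)
qed

text \<open>A uniform element of \<open>S \<inter> D\<close>, for a uniform proposal
  \<open>S\<close> meeting \<open>D\<close>, is uniform on \<open>D\<close>. After exchanging the
  sums, \<open>w i\<close> is the total weight given to \<open>i\<close>, and by symmetry it is
  constant on \<open>D\<close>.\<close>

lemma sum_hitting_proposals:
  fixes h :: "nat \<Rightarrow> real"
  assumes Z: "finite Z" "D \<subseteq> Z" "D \<noteq> {}"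
  shows "(\<Sum>S\<in>hitting_proposals r Z D. (\<Sum>i\<in>S \<inter> D. h i) / card (S \<inter> D)) =
    card (hitting_proposals r Z D) * ((\<Sum>i\<in>D. h i) / card D)"
proof -
  define A where "A = hitting_proposals r Z D"
  define w where "w i = (\<Sum>S\<in>{S \<in> A. i \<in> S}. 1 / real (card (S \<inter> D)))" for i
  have finA: "finite A" using finite_proposals[OF Z(1)] by (simp add: A_def hitting_proposals_def)
  have finD: "finite D" using Z finite_subset by auto
  have swap: "(\<Sum>S\<in>A. (\<Sum>i\<in>S \<inter> D. h i) / card (S \<inter> D)) = (\<Sum>i\<in>D. w i * h i)" for h
  proof -
    have "(\<Sum>S\<in>A. (\<Sum>i\<in>S \<inter> D. h i) / card (S \<inter> D)) =
        (\<Sum>S\<in>A. \<Sum>i\<in>{i \<in> D. i \<in> S}. h i / card (S \<inter> D))"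
      by (auto simp: sum_divide_distrib intro!: sum.cong)
    also have "\<dots> = (\<Sum>i\<in>D. \<Sum>S\<in>{S \<in> A. i \<in> S}. h i / card (S \<inter> D))"
      using finA finD by (rule sum.swap_restrict)
    finally show ?thesis by (simp add: w_def sum_distrib_right)
  qed
  have w_eq: "w i = w j" if ij: "i \<in> D" "j \<in> D" for i j
  proof -
    \<comment> \<open>Swapping \<open>i\<close> and \<open>j\<close> preserves \<open>Z\<close> and
      \<open>D\<close>, so it permutes the hitting proposals and carries those containing
      \<open>i\<close> to those containing \<open>j\<close>.\<close>
    let ?t = "Transposition.transpose i j"
    have tD: "?t ` D = D" and tZ: "?t ` Z = Z" using ij subsetD[OF Z(2)] by (simp_all add: transpose_image_eq)
    have inj: "inj ?t" by simp
    have cap: "?t ` S \<inter> D = ?t ` (S \<inter> D)" for S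
      using image_Int[OF inj, of S D] tD by simp
    have card: "card (?t ` S \<inter> D) = card (S \<inter> D)" for S
      unfolding cap by (intro card_image inj_on_subset[OF inj]) auto
    have cardS: "card (?t ` S) = card S" for S
      by (intro card_image inj_on_subset[OF inj]) auto
    have mem: "?t ` S \<in> A" if "S \<in> A" for S
    proof -
      have "?t ` S \<subseteq> Z" using that tZ
        by (auto simp: A_def hitting_proposals_def proposals_def)
      moreover have "?t ` S \<inter> D \<noteq> {}" using that
        unfolding cap by (auto simp: A_def hitting_proposals_def)
      ultimately show ?thesis
        using that by (simp add: A_def hitting_proposals_def proposals_def cardS)
    qed
    have invol: "?t ` ?t ` S = S" for S by (simp add: image_image)
    have i: "j \<in> ?t ` S" if "i \<in> S" for S using that by (metis image_eqI transpose_apply_first)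
    have j: "i \<in> ?t ` S" if "j \<in> S" for S using that by (metis image_eqI transpose_apply_second)
    show ?thesis unfolding w_def
      by (rule sum.reindex_bij_witness[where i = "\<lambda>S. ?t ` S" and j = "\<lambda>S. ?t ` S"])
        (use mem invol card i j in auto)
  qed
  obtain i0 where i0: "i0 \<in> D" using Z(3) by auto
  have sum_w: "(\<Sum>i\<in>D. w i * h i) = w i0 * (\<Sum>i\<in>D. h i)" for h
    using w_eq[OF _ i0] by (simp add: sum_distrib_left)
  \<comment> \<open>The choice \<open>h = 1\<close> determines the common weight, since each hitting
    proposal contributes exactly 1.\<close>
  have "real (card A) = (\<Sum>S\<in>A. (\<Sum>i\<in>S \<inter> D. 1) / card (S \<inter> D))"
  proof -
    have "card (S \<inter> D) \<noteq> 0" if "S \<in> A" for S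
      using that finD by (auto simp: A_def hitting_proposals_def)
    then have "(\<Sum>S\<in>A. (\<Sum>i\<in>S \<inter> D. 1) / real (card (S \<inter> D))) = (\<Sum>S\<in>A. 1)"
      by (intro sum.cong) auto
    then show ?thesis by simp
  qed
  also have "\<dots> = w i0 * card D" unfolding swap sum_w by simp
  finally have "w i0 = card A / card D" using finD Z(3) by (simp add: field_simps)
  then show ?thesis unfolding A_def[symmetric] swap sum_w by simp
qed

section \<open>The greedy policy and its success probability\<close>

definition greedy_policy :: "nat set \<Rightarrow> policy" where
  "greedy_policy R h S = pmf_of_set (if S \<inter> R = {} then S else S \<inter> R)"

lemma valid_greedy_policy: "valid_policy (greedy_policy R)"
  by (auto simp: valid_policy_def greedy_policy_def)

text \<open>A proposal meeting \<open>D\<close> leads to a uniform element of \<open>D\<close> by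
  \<open>sum_hitting_proposals\<close>; any other proposal contains irrelevant zeros only, all of
  which give the value \<open>c\<close>.\<close>

lemma choice_step_greedy:
  assumes sub: "state h \<subseteq> {..<n}" and r: "r \<ge> 1"
    and D: "D = R \<inter> ({..<n} - state h)" "D \<noteq> {}"
    and irrelevant: "\<And>i. i \<in> {..<n} - state h \<Longrightarrow> i \<notin> R \<Longrightarrow> \<Phi> (insert i (state h)) = c"
    and frac: "\<rho> = card (hitting_proposals r ({..<n} - state h) D) / card (proposals r ({..<n} - state h))"
  shows "choice_step r (greedy_policy R) n \<Phi> h =
    (1 - \<rho>) * c + \<rho> * ((\<Sum>i\<in>D. \<Phi> (insert i (state h))) / card D)"
proof -
  define Z where "Z = {..<n} - state h"
  define P where "P = proposals r Z"
  define A where "A = hitting_proposals r Z D"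
  define H where "H i = \<Phi> (insert i (state h))" for i
  have Z: "finite Z" "D \<subseteq> Z" "Z \<noteq> {}" using D by (auto simp: Z_def)
  have fin: "finite P" "A \<subseteq> P" "finite A"
    using finite_proposals[OF Z(1), of r] by (auto simp: P_def A_def hitting_proposals_def)
  have S: "S \<subseteq> Z" "finite S" "S \<noteq> {}" "S \<inter> R = S \<inter> D" if "S \<in> P" for S
    using proposalsD[OF that[unfolded P_def] Z(1,3) r] D(1) by (auto simp: Z_def)
  have hit: "measure_pmf.expectation (greedy_policy R h S) H = (\<Sum>i\<in>S \<inter> D. H i) / card (S \<inter> D)"
    if "S \<in> A" for S
  proof -
    have "S \<inter> D \<noteq> {}" "S \<in> P" using that by (auto simp: A_def P_def hitting_proposals_def)
    then show ?thesis using S[of S] by (simp add: greedy_policy_def integral_pmf_of_set)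
  qed
  have miss: "measure_pmf.expectation (greedy_policy R h S) H = c" if "S \<in> P - A" for S
  proof -
    have SD: "S \<inter> R = {}" "S \<in> P" using that S(4)[of S] by (auto simp: A_def P_def hitting_proposals_def)
    then have "(\<Sum>i\<in>S. H i) = (\<Sum>i\<in>S. c)"
      using S(1)[of S] irrelevant by (intro sum.cong refl) (auto simp: H_def Z_def)
    then show ?thesis using S[of S] SD by (simp add: greedy_policy_def integral_pmf_of_set)
  qed
  have "(\<Sum>S\<in>P. measure_pmf.expectation (greedy_policy R h S) H) =
      (\<Sum>S\<in>P - A. measure_pmf.expectation (greedy_policy R h S) H) +
      (\<Sum>S\<in>A. measure_pmf.expectation (greedy_policy R h S) H)"
    using fin by (intro sum.subset_diff)
  also have "(\<Sum>S\<in>P - A. measure_pmf.expectation (greedy_policy R h S) H) = (card P - real (card A)) * c"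
    using fin by (simp add: miss card_Diff_subset card_mono of_nat_diff)
  also have "(\<Sum>S\<in>A. measure_pmf.expectation (greedy_policy R h S) H) = card A * ((\<Sum>i\<in>D. H i) / card D)"
    using sum_hitting_proposals[OF Z(1,2) D(2), of H r] by (simp add: hit A_def)
  finally have "choice_step r (greedy_policy R) n \<Phi> h =
      ((card P - real (card A)) * c + card A * ((\<Sum>i\<in>D. H i) / card D)) / card P"
    unfolding choice_step_def Z_def[symmetric] P_def[symmetric] H_def by simp
  also have "\<dots> = (1 - card A / card P) * c + card A / card P * ((\<Sum>i\<in>D. H i) / card D)"
  proof -
    have "card P > 0" using card_proposals_pos[OF Z(1)] by (simp add: P_def)
    then show ?thesis by (simp add: add_divide_distrib diff_divide_distrib algebra_simps)
  qed
  finally show ?thesis by (simp add: frac A_def P_def Z_def H_def)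
qed

text \<open>The number \<open>k\<close> of relevant coordinates already set is driven up to \<open>a\<close>.  The potential is the success
  probability after \<open>a - k\<close> further uniform relevant coordinates, minus an exponential-moment bound
  for the probability of collecting fewer than those in the \<open>s\<close> steps left.\<close>

lemma greedy_policy_success:
  fixes f :: "nat set \<Rightarrow> bool" and u \<rho> :: real
  assumes R: "R \<subseteq> {..<n}" and restrict: "\<And>X. X \<subseteq> {..<n} \<Longrightarrow> f X = f (X \<inter> R)"
    and mono: "mono_on (Pow R) (\<lambda>X. of_bool (f X) :: real)"
    and r: "r \<ge> 1" and a: "a \<le> card R" and u: "0 < u" "u < 1"
    and \<rho>: "\<rho> = real r * real (card R - a) / (real n + real r * real (card R - a))"
  shows "walk_avg R a (\<lambda>X. of_bool (f X)) {} - (1/u) ^ a * (1 - \<rho> * (1 - u)) ^ t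
    \<le> measure_pmf.prob (choice_process r (greedy_policy R) n t) {h. f (state h)}"
proof -
  define g where "g = (\<lambda>X. of_bool (f X) :: real)"
  define m where "m = card R"
  \<comment> \<open>The penalty \<open>b\<close> is at least 1 while \<open>k < a\<close> and
    vanishes afterwards. A new relevant coordinate multiplies it by at most \<open>u\<close>, so a
    hitting chance of at least \<open>\<rho>\<close> shrinks it on average by the factor
    \<open>c\<close>.\<close>
  define c where "c = 1 - \<rho> * (1 - u)"
  define b where "b k = (if k < a then (1/u) ^ (a - k) else 0)" for k
  define \<Phi> where "\<Phi> s Y = walk_avg R (a - card (Y \<inter> R)) g (Y \<inter> R) - b (card (Y \<inter> R)) * c ^ s" for s Y
  have finR: "finite R" using R finite_subset by auto
  have g01: "0 \<le> g X" "g X \<le> 1" for X by (auto simp: g_def)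
  have \<rho>01: "0 \<le> \<rho>" "\<rho> \<le> 1"
  proof -
    have "x / (real n + x) \<le> 1" if "x \<ge> 0" for x
    proof (cases "real n + x = 0")
      case False
      then have "real n + x > 0" using that by linarith
      then show ?thesis by simp
    qed simp
    then show "0 \<le> \<rho>" "\<rho> \<le> 1" unfolding \<rho> by simp_all
  qed
  have c0: "0 \<le> c" using \<rho>01 u by (simp add: c_def mult_le_one)
  have b_nonneg: "0 \<le> b k" for k using u by (simp add: b_def)
  have b_Suc: "b (Suc k) \<le> u * b k" for k
  proof (cases "Suc k < a")
    case True
    then have "a - k = Suc (a - Suc k)" by simp
    then show ?thesis using True u by (simp add: b_def)
  qed (use u in \<open>auto simp: b_def\<close>)
  have full: "\<Phi> s {..<n} = g R" for s
    using R a by (simp add: \<Phi>_def b_def Int_absorb1)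
  have step: "\<Phi> (Suc s) (state h) \<le> choice_step r (greedy_policy R) n (\<Phi> s) h"
    if sub: "state h \<subset> {..<n}" for s h
  proof -
    define Y where "Y = state h"
    define Z where "Z = {..<n} - Y"
    define X where "X = Y \<inter> R"
    define k where "k = card X"
    define D where "D = R \<inter> Z"
    have Y: "Y \<subseteq> {..<n}" and Z: "Z \<noteq> {}" "finite Z" using sub by (auto simp: Y_def Z_def)
    have D_eq: "D = R - X" using R by (auto simp: D_def Z_def X_def)
    have X: "X \<subseteq> R" "finite X" using finR by (auto simp: X_def)
    have cardD: "card D = m - k" using X finR by (simp add: D_eq card_Diff_subset m_def k_def)
    have irr: "\<Phi> s (insert i Y) = \<Phi> s Y" if "i \<notin> R" for i s
      using that by (simp add: \<Phi>_def)
    have rel: "\<Phi> s (insert i Y) = walk_avg R (a - Suc k) g (insert i X) - b (Suc k) * c ^ s"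
      if "i \<in> D" for i s
    proof -
      have "insert i Y \<inter> R = insert i X" "i \<notin> X"
        using that by (auto simp: D_eq X_def)
      then show ?thesis using X(2) by (simp add: \<Phi>_def k_def)
    qed
    define \<rho>' where "\<rho>' = card (hitting_proposals r Z D) / card (proposals r Z)"
    have \<rho>'01: "0 \<le> \<rho>'" "\<rho>' \<le> 1"
    proof -
      have "card (hitting_proposals r Z D) \<le> card (proposals r Z)"
        using finite_proposals[OF Z(2)] by (intro card_mono) (auto simp: hitting_proposals_def)
      then show "0 \<le> \<rho>'" "\<rho>' \<le> 1" by (auto simp: \<rho>'_def divide_le_eq)
    qed
    show ?thesis
    proof (cases "D = {}")
      \<comment> \<open>All relevant coordinates are set, so \<open>k = m \<ge> a\<close>: the
        penalty is gone and no move changes the potential.\<close>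
      case True
      then have k: "k = m" using X D_eq by (auto simp: k_def m_def)
      have notR: "i \<notin> R" if "i \<in> Z" for i using that True by (auto simp: D_def)
      have \<Phi>Y: "\<Phi> s Y = \<Phi> (Suc s) Y" using a k by (simp add: \<Phi>_def b_def k_def X_def m_def)
      have "measure_pmf.expectation (greedy_policy R h S) (\<lambda>i. \<Phi> s (insert i Y)) = \<Phi> s Y"
        if "S \<in> proposals r Z" for S
      proof -
        have "\<Phi> s (insert i Y) = \<Phi> s Y" if "i \<in> set_pmf (greedy_policy R h S)" for i
          using policy_support(2)[OF valid_greedy_policy r \<open>S \<in> _\<close> Z(2,1)] that notR irr by blast
        then have "measure_pmf.expectation (greedy_policy R h S) (\<lambda>i. \<Phi> s (insert i Y)) =
            measure_pmf.expectation (greedy_policy R h S) (\<lambda>i. \<Phi> s Y)"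
          by (intro integral_cong_AE) (auto simp: AE_measure_pmf_iff)
        then show ?thesis by simp
      qed
      then have "choice_step r (greedy_policy R) n (\<Phi> s) h = \<Phi> s Y"
        using card_proposals_pos[OF Z(2), of r]
        by (simp add: choice_step_def Y_def[symmetric] Z_def[symmetric])
      then show ?thesis using \<Phi>Y by (simp add: Y_def)
    next
      case False
      have split: "choice_step r (greedy_policy R) n (\<Phi> s) h =
          (1 - \<rho>') * \<Phi> s Y + \<rho>' * ((\<Sum>i\<in>D. \<Phi> s (insert i Y)) / card D)"
        using choice_step_greedy[of h n r D R "\<Phi> s" "\<Phi> s Y" \<rho>'] Y r False irr
        by (simp add: Y_def[symmetric] Z_def[symmetric] D_def \<rho>'_def)
      have cD: "card D > 0" using False finR by (simp add: D_eq card_gt_0_iff)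
      define Q where "Q = (\<Sum>i\<in>D. walk_avg R (a - Suc k) g (insert i X)) / card D"
      have avg: "(\<Sum>i\<in>D. \<Phi> s (insert i Y)) / card D = Q - b (Suc k) * c ^ s"
        using cD by (simp add: rel sum_subtractf diff_divide_distrib Q_def)
      have monoW: "mono_on (Pow R) (walk_avg R (a - Suc k) g)"
        using finR mono by (intro mono_on_walk_avg) (simp_all add: g_def)
      have Q_step: "Q = walk_step R (walk_avg R (a - Suc k) g) X"
        using False by (simp add: Q_def walk_step_def D_eq)
      show ?thesis
      proof (cases "k < a")
        case True
        then have "a - k = Suc (a - Suc k)" by simp
        then have Q: "walk_avg R (a - k) g X = Q" using Q_step by simp
        \<comment> \<open>While \<open>k < a\<close>, at least \<open>card R - a\<close> relevant
          zeros remain, so the fixed \<open>\<rho>\<close> is a lower bound for the current hitting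
          chance.\<close>
        have \<rho>_le: "\<rho> \<le> \<rho>'"
          unfolding \<rho> \<rho>'_def
        proof (rule hitting_fraction_ge)
          show "card Z \<le> n" unfolding Z_def
            by (metis Diff_subset card_lessThan card_mono finite_lessThan)
          show "card R - a \<le> card D" using True by (simp add: cardD m_def)
        qed (use Z False r in \<open>auto simp: D_def\<close>)
        have "choice_step r (greedy_policy R) n (\<Phi> s) h =
            Q - c ^ s * ((1 - \<rho>') * b k + \<rho>' * b (Suc k))"
          unfolding split avg using Q by (simp add: \<Phi>_def X_def[symmetric] k_def[symmetric] algebra_simps)
        also have "\<dots> \<ge> Q - c ^ s * (b k * c)"
        proof -
          have "\<rho>' * b (Suc k) \<le> \<rho>' * (u * b k)"
            using \<rho>'01 b_Suc by (intro mult_left_mono) auto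
          then have "(1 - \<rho>') * b k + \<rho>' * b (Suc k) \<le> b k * (1 - \<rho>' * (1 - u))"
            by (simp add: algebra_simps)
          also have "\<dots> \<le> b k * c"
            unfolding c_def using \<rho>_le u b_nonneg by (intro mult_left_mono diff_left_mono mult_right_mono) auto
          finally show ?thesis using c0 by (intro diff_left_mono mult_left_mono) auto
        qed
        also have "Q - c ^ s * (b k * c) = \<Phi> (Suc s) Y"
          using Q by (simp add: \<Phi>_def X_def[symmetric] k_def[symmetric])
        finally show ?thesis by (simp add: Y_def)
      next
        \<comment> \<open>The target is reached: the potential is \<open>g\<close> itself, which
          further relevant coordinates can only raise.\<close>
        case b0: False
        have "g X \<le> Q"
          using Q_step walk_step_ge[OF finR monoW X(1)] b0 by simp
        then have "\<rho>' * g X \<le> \<rho>' * Q" using \<rho>'01 by (intro mult_left_mono)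
        moreover have "\<Phi> s Y = g X" "\<Phi> (Suc s) Y = g X" "b (Suc k) = 0"
          using b0 by (auto simp: \<Phi>_def b_def X_def[symmetric] k_def[symmetric])
        ultimately show ?thesis unfolding split avg Y_def[symmetric] by (simp add: algebra_simps)
      qed
    qed
  qed
  have "walk_avg R a g {} - (1/u) ^ a * c ^ t \<le> \<Phi> (0 + t) {}"
    using c0 by (simp add: \<Phi>_def b_def)
  also have "\<dots> \<le> measure_pmf.expectation (choice_process r (greedy_policy R) n t) (\<lambda>h. \<Phi> 0 (state h))"
    by (rule choice_process_potential_ge[where \<Phi> = \<Phi>])
      (use valid_greedy_policy r full step in auto)
  also have "\<dots> \<le> measure_pmf.expectation (choice_process r (greedy_policy R) n t) (indicator {h. f (state h)})"
  proof (rule integral_mono_AE)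
    note supp = choice_process_support[OF valid_greedy_policy[of R] r, of n t]
    then show "integrable (choice_process r (greedy_policy R) n t) (\<lambda>h. \<Phi> 0 (state h))"
      "integrable (choice_process r (greedy_policy R) n t) (indicator {h. f (state h)} :: _ \<Rightarrow> real)"
      by (auto intro: integrable_measure_pmf_finite)
    \<comment> \<open>With no steps left, a shortfall costs at least 1 and outweighs the walk
      average.\<close>
    have "\<Phi> 0 Y \<le> g Y" if Y: "Y \<subseteq> {..<n}" for Y
    proof (cases "card (Y \<inter> R) < a")
      case True
      have "1 \<le> (1/u) ^ (a - card (Y \<inter> R))" using u by (intro one_le_power) simp
      moreover have "walk_avg R (a - card (Y \<inter> R)) g (Y \<inter> R) \<le> 1"
        using finR g01 by (intro walk_avg_le_1)
      ultimately show ?thesis using True g01(1)[of Y] by (simp add: \<Phi>_def b_def)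
    next
      case False
      then show ?thesis using restrict[OF Y] by (simp add: \<Phi>_def b_def g_def)
    qed
    then have "\<Phi> 0 (state h) \<le> indicator {h. f (state h)} h" if "state h \<subseteq> {..<n}" for h
      using that by (fastforce simp: g_def indicator_def of_bool_def)
    then show "AE h in choice_process r (greedy_policy R) n t. \<Phi> 0 (state h) \<le> indicator {h. f (state h)} h"
      using supp by (simp add: AE_measure_pmf_iff)
  qed
  finally show ?thesis by (simp add: g_def c_def)
qed

section \<open>Hitting times\<close>

definition hitting_time :: "'a set \<Rightarrow> ('a set \<Rightarrow> bool) \<Rightarrow> nat" where
  "hitting_time V f =
     (LEAST t. t \<le> card V \<and> 1/2 \<le> walk_avg V t (\<lambda>X. of_bool (f X)) {})"

lemma hitting_time_le:
  "t \<le> card V \<Longrightarrow> 1/2 \<le> walk_avg V t (\<lambda>X. of_bool (f X)) {} \<Longrightarrow> hitting_time V f \<le> t"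
  unfolding hitting_time_def by (rule Least_le) simp

lemma hitting_time_works:
  assumes "finite V" "f V"
  shows "hitting_time V f \<le> card V"
    and "1/2 \<le> walk_avg V (hitting_time V f) (\<lambda>X. of_bool (f X)) {}"
proof -
  have "walk_avg V (card V) (\<lambda>X. of_bool (f X) :: real) {} = 1"
    using walk_avg_absorbed[OF assms(1), of "{}" "card V"] assms(2) by simp
  then have "\<exists>t. t \<le> card V \<and> 1/2 \<le> walk_avg V t (\<lambda>X. of_bool (f X)) {}"
    by (intro exI[of _ "card V"]) simp
  from LeastI_ex[OF this] show "hitting_time V f \<le> card V"
    "1/2 \<le> walk_avg V (hitting_time V f) (\<lambda>X. of_bool (f X)) {}"
    by (auto simp: hitting_time_def)
qed

lemma hitting_time_empty: "f {} \<Longrightarrow> hitting_time V f = 0"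
  unfolding hitting_time_def by (rule Least_equality) auto

text \<open>For the constant 0 no time qualifies, and \<open>LEAST\<close> returns one fixed
  unspecified number; a hitting time tending to infinity eventually excludes it.\<close>

lemma hitting_time_never:
  assumes "finite V" "mono_on (Pow V) (\<lambda>X. of_bool (f X) :: real)" "\<not> f V"
  shows "hitting_time V f = (LEAST t. False)"
proof -
  have "walk_avg V t (\<lambda>X. of_bool (f X)) {} \<le> 0" for t
  proof -
    have "walk_avg V t (\<lambda>X. of_bool (f X)) {} \<le> walk_avg V (max t (card V)) (\<lambda>X. of_bool (f X) :: real) {}"
      using assms by (intro walk_avg_mono_time) auto
    also have "\<dots> = 0"
      using walk_avg_absorbed[OF assms(1), of "{}"] assms(3) by simp
    finally show ?thesis .
  qed
  then have "\<not> 1/2 \<le> walk_avg V t (\<lambda>X. of_bool (f X)) {}" for t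
    by (meson half_gt_zero_iff less_le_trans not_le zero_less_one)
  then show ?thesis unfolding hitting_time_def by simp
qed

text \<open>Used to show that \<open>card V * p\<close> is large whenever the hitting time
  is.\<close>

lemma hitting_time_le_linear:
  fixes V :: "'a set" and p :: real
  assumes "finite V" "mono_on (Pow V) (\<lambda>X. of_bool (f X) :: real)" "f V"
    and p: "0 \<le> p" "p \<le> 1" and half: "biased V p (\<lambda>X. of_bool (f X)) = 1/2"
  shows "hitting_time V f \<le> 4 * (card V * p) + 5"
proof -
  define y where "y = card V * p"
  \<comment> \<open>Chosen for \<open>\<alpha> = 2\<close>: the boosted failure probability is at
    most 1/4, and the offset 4 keeps the Chebyshev loss at most 1/4 for every
    \<open>y \<ge> 0\<close>.\<close>
  define a where "a = nat \<lceil>4 * y + 4\<rceil>"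
  have y: "0 \<le> y" using p by (simp add: y_def)
  have a: "4 * y + 4 \<le> a" "a \<le> 4 * y + 5" using y unfolding a_def by linarith+
  have "hitting_time V f \<le> a"
  proof (cases "a \<le> card V")
    case True
    have "2 * y / (a - 2 * y)\<^sup>2 \<le> 2 * y / (2 * y + 4)\<^sup>2"
      using a y by (intro frac_le power_mono zero_less_power) auto
    also have "\<dots> \<le> 1/4"
      using y by (simp add: divide_le_eq power2_eq_square algebra_simps)
    finally have "1/2 \<le> 1 - 2 powr (-2) - 2 * y / (a - 2 * y)\<^sup>2"
      by (simp add: powr_minus_divide)
    also have "\<dots> \<le> walk_avg V a (\<lambda>X. of_bool (f X)) {}"
      using walk_avg_boost[OF assms(1,2) p half, of 2 a] a y by (simp add: y_def)
    finally show ?thesis using True by (intro hitting_time_le)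
  next
    case False
    then show ?thesis using hitting_time_works(1)[of V f] assms by simp
  qed
  then show ?thesis using a by (simp add: y_def)
qed

text \<open>The assumption \<open>large\<close> keeps the Chebyshev loss in
  \<open>walk_avg_le_near_threshold\<close> below the distance from
  \<open>1 - 2 powr (-1/\<alpha>)\<close> to 1/2.\<close>

lemma hitting_time_gt:
  fixes V :: "'a set" and p \<alpha> :: real
  assumes "finite V" "mono_on (Pow V) (\<lambda>X. of_bool (f X) :: real)" "f V"
    and p: "0 \<le> p" "p \<le> 1" and half: "biased V p (\<lambda>X. of_bool (f X)) = 1/2"
    and \<alpha>: "1 < \<alpha>" and pos: "0 < card V * p"
    and large: "\<alpha> ^ 4 / (\<alpha> - 1)\<^sup>2 / (card V * p) < 2 powr (-1/\<alpha>) - 1/2"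
  shows "card V * p / \<alpha>\<^sup>2 < hitting_time V f"
proof (rule ccontr)
  assume "\<not> ?thesis"
  then have "walk_avg V (hitting_time V f) (\<lambda>X. of_bool (f X)) {} < 1/2"
    using walk_avg_le_near_threshold[OF assms(1,2) p half \<alpha>, of "hitting_time V f"] pos large by simp
  then show False using hitting_time_works(2)[of V f] assms by simp
qed

section \<open>Hitting times of the walk and of the choice process\<close>

lemma T_walk_eq_hitting_time: "T_walk n f = hitting_time {..<n} f"
  by (simp add: T_walk_def hitting_time_def prob_random_walk)

lemma relevant_subset: "relevant n f \<subseteq> {..<n}"
  by (auto simp: relevant_def)

lemma finite_relevant: "finite (relevant n f)"
  using relevant_subset finite_subset by blast

lemma T_walk_relevant_contraction:
  "T_walk (card (relevant n f)) (relevant_contraction n f) = hitting_time (relevant n f) f"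
proof -
  define R where "R = relevant n f"
  define e where "e = (\<lambda>j. sorted_list_of_set R ! j)"
  have "bij_betw e {..<card R} R"
    unfolding e_def using finite_relevant by (intro bij_betw_nth) (auto simp: R_def)
  then have e: "inj_on e {..<card R}" "e ` {..<card R} = R"
    by (auto simp: bij_betw_def)
  have "walk_avg (e ` {..<card R}) t (\<lambda>X. of_bool (f X)) {} =
      walk_avg {..<card R} t (\<lambda>x. of_bool (relevant_contraction n f x) :: real) {}" for t
    using walk_avg_image[OF e(1), of "{}" t "\<lambda>X. of_bool (f X)"]
    by (simp add: relevant_contraction_def e_def R_def)
  then show ?thesis
    by (simp add: T_walk_eq_hitting_time hitting_time_def e(2) R_def[symmetric])
qed

lemma monotone_boolean_mono_on:
  "monotone_boolean n f \<Longrightarrow> mono_on (Pow {..<n}) (\<lambda>X. of_bool (f X) :: real)"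
  by (auto simp: monotone_boolean_def monotone_on_def)

lemma relevant_Int:
  assumes "X \<subseteq> {..<n}"
  shows "f X = f (X \<inter> relevant n f)"
  by (rule relevant_agree[OF assms]) (use assms in auto)

lemma T_choice_le:
  "t \<le> n \<Longrightarrow> valid_policy \<pi> \<Longrightarrow> 1/2 \<le> measure_pmf.prob (choice_process r \<pi> n t) {h. f (state h)} \<Longrightarrow>
    T_choice r n f \<le> t"
  unfolding T_choice_def by (rule Least_le) auto

text \<open>The witnesses \<open>t\<close> and \<open>\<pi>\<close> guarantee that the minimum
  defining \<open>T_choice\<close> is attained. If \<open>r * s\<close> exceeds \<open>n\<close>,
  the bound follows from \<open>T_walk n f \<le> n\<close>.\<close>

lemma T_walk_le_T_choice:
  assumes mono: "monotone_boolean n f" and r: "r \<ge> 1" and full: "f {..<n}"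
    and t: "t \<le> n" "valid_policy \<pi>" "1/2 \<le> measure_pmf.prob (choice_process r \<pi> n t) {h. f (state h)}"
  shows "T_walk n f \<le> r * T_choice r n f"
proof -
  define s where "s = T_choice r n f"
  have "\<exists>\<pi>. valid_policy \<pi> \<and> 1/2 \<le> measure_pmf.prob (choice_process r \<pi> n s) {h. f (state h)}"
    unfolding s_def T_choice_def using t
    by (rule_tac LeastI2[where a = t]) auto
  then obtain \<pi>' where \<pi>': "valid_policy \<pi>'"
    "1/2 \<le> measure_pmf.prob (choice_process r \<pi>' n s) {h. f (state h)}" by blast
  then have "1/2 \<le> walk_avg {..<n} (r * s) (\<lambda>X. of_bool (f X)) {}"
    using prob_choice_process_le[OF \<pi>'(1) r monotone_boolean_mono_on[OF mono], of s] by simp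
  then show ?thesis
    using hitting_time_le[of "r * s" "{..<n}" f] hitting_time_works(1)[of "{..<n}" f] full
    by (cases "r * s \<le> n") (auto simp: T_walk_eq_hitting_time s_def)
qed

text \<open>The exponent 9 adds up as follows. The target \<open>a\<close> costs
  \<open>\<alpha>\<^sup>2\<close>, and one more factor for rounding; the rate \<open>\<rho>\<close>
  loses \<open>\<alpha>\<^sup>2\<close>, and the exponential-moment bound needs one factor of slack,
  which gives \<open>\<alpha> ^ 6\<close> in \<open>t\<close>. Rounding \<open>t\<close> costs one
  factor, and comparing \<open>n * p\<close> with \<open>T_walk n f\<close> the last two.\<close>

lemma T_choice_between:
  fixes f :: "nat set \<Rightarrow> bool" and n r :: nat and p \<alpha> :: real
  defines "R \<equiv> relevant n f"
  defines "y \<equiv> card R * p"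
  assumes mono: "monotone_boolean n f" and r: "r \<ge> 1" and full: "f R"
    and p: "0 \<le> p" "p \<le> 1" and half: "biased R p (\<lambda>X. of_bool (f X)) = 1/2"
    and \<alpha>: "1 < \<alpha>"
    and y: "1 \<le> y * (\<alpha> ^ 3 - \<alpha>\<^sup>2)" "1 \<le> y * (\<alpha> ^ 7 - \<alpha> ^ 6) / r"
    and small: "\<alpha> ^ 3 * p \<le> 1 - 1/\<alpha>" "\<alpha> ^ 7 * p \<le> 1" "r * (card R / n) \<le> \<alpha> - 1"
    and slow: "\<alpha> ^ 4 / (\<alpha> - 1)\<^sup>2 / y < 2 powr (-1/\<alpha>) - 1/2"
    and fast: "1 / (\<alpha> * (\<alpha> - 1)\<^sup>2) / y + exp (- (\<alpha> - 1)\<^sup>2 / (2 * (\<alpha> + 1)) * y) \<le> 1/2 - 2 powr (-\<alpha>)"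
  shows "0 < T_walk n f" "T_walk n f \<le> r * T_choice r n f"
    "r * T_choice r n f \<le> \<alpha> ^ 9 * T_walk n f"
proof -
  define m where "m = card R"
  have finR: "finite R" and R: "R \<subseteq> {..<n}"
    using finite_relevant relevant_subset by (auto simp: R_def)
  have monoV: "mono_on (Pow {..<n}) (\<lambda>X. of_bool (f X) :: real)"
    using mono by (rule monotone_boolean_mono_on)
  then have monoR: "mono_on (Pow R) (\<lambda>X. of_bool (f X) :: real)"
    by (rule mono_on_subset) (use R in auto)
  have fullV: "f {..<n}" using mono full R by (auto simp: monotone_boolean_def)
  have ym: "y = m * p" by (simp add: y_def m_def)
  have y0: "0 < y"
  proof -
    have "\<alpha> ^ 3 - \<alpha>\<^sup>2 > 0" using \<alpha> power_strict_increasing[of 2 3 \<alpha>] by simp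
    moreover have "0 < y * (\<alpha> ^ 3 - \<alpha>\<^sup>2)" using y by simp
    ultimately show ?thesis by (simp add: zero_less_mult_iff)
  qed
  then have m0: "0 < m" and p0: "0 < p" using p by (auto simp: ym zero_less_mult_iff)
  have mn: "m \<le> n" using card_mono[OF _ R] by (simp add: m_def)
  have n0: "0 < n" using m0 mn by simp
  have yn: "y \<le> n * p" using mn p by (simp add: ym mult_right_mono)
  have halfV: "biased {..<n} p (\<lambda>X. of_bool (f X)) = 1/2"
    using biased_restrict[of "{..<n}" R "\<lambda>X. of_bool (f X)" p] R half relevant_Int[of _ n f]
    by (simp add: R_def)
  have "\<alpha> ^ 4 / (\<alpha> - 1)\<^sup>2 / (card {..<n} * p) \<le> \<alpha> ^ 4 / (\<alpha> - 1)\<^sup>2 / y"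
    using yn y0 \<alpha> by (intro frac_le) auto
  then have T1: "n * p / \<alpha>\<^sup>2 < T_walk n f"
    using hitting_time_gt[OF _ monoV fullV p halfV \<alpha>] n0 p0 slow by (simp add: T_walk_eq_hitting_time)
  moreover have "0 \<le> n * p / \<alpha>\<^sup>2" using p by simp
  ultimately show "0 < T_walk n f" by linarith

  define a where "a = nat \<lceil>\<alpha>\<^sup>2 * y\<rceil>"
  have "0 \<le> \<alpha>\<^sup>2 * y" using y0 by simp
  then have a: "\<alpha>\<^sup>2 * y \<le> a" "a \<le> \<alpha>\<^sup>2 * y + 1"
    unfolding a_def by linarith+
  then have a3: "a \<le> \<alpha> ^ 3 * y" using y(1) by (simp add: algebra_simps)
  also have "\<dots> = m * (\<alpha> ^ 3 * p)" by (simp add: ym)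
  also have "\<dots> \<le> m * (1 - 1/\<alpha>)" using small(1) by (intro mult_left_mono) auto
  finally have a_m: "m / \<alpha> \<le> m - real a" by (simp add: algebra_simps)
  moreover have "0 \<le> m / \<alpha>" using \<alpha> by simp
  ultimately have am: "a \<le> m" by linarith
  have ya: "y \<le> a"
  proof -
    have "1 * y \<le> \<alpha>\<^sup>2 * y" using \<alpha> y0 by (intro mult_right_mono) (auto simp: one_le_power)
    then show ?thesis using a by simp
  qed

  define t where "t = nat \<lceil>\<alpha> ^ 6 * (n * p) / r\<rceil>"
  have "0 \<le> \<alpha> ^ 6 * (n * p) / r" using \<alpha> p by simp
  then have t: "\<alpha> ^ 6 * (n * p) / r \<le> t" "t \<le> \<alpha> ^ 6 * (n * p) / r + 1"
    unfolding t_def by linarith+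
  have t7: "t \<le> \<alpha> ^ 7 * (n * p) / r"
  proof -
    have "\<alpha> ^ 7 - \<alpha> ^ 6 \<ge> 0" using \<alpha> power_increasing[of 6 7 \<alpha>] by simp
    then have "y * (\<alpha> ^ 7 - \<alpha> ^ 6) / r \<le> n * p * (\<alpha> ^ 7 - \<alpha> ^ 6) / r"
      using yn by (intro divide_right_mono mult_right_mono) auto
    then have "1 \<le> n * p * (\<alpha> ^ 7 - \<alpha> ^ 6) / r" using y(2) by linarith
    also have "\<dots> = \<alpha> ^ 7 * (n * p) / r - \<alpha> ^ 6 * (n * p) / r"
      by (simp add: algebra_simps diff_divide_distrib)
    finally show ?thesis using t by linarith
  qed
  have tn: "t \<le> n"
  proof -
    have "\<alpha> ^ 7 * (n * p) / r = n * (\<alpha> ^ 7 * p) / r" by simp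
    also have "\<dots> \<le> real n * 1 / 1"
    proof (rule frac_le)
      show "n * (\<alpha> ^ 7 * p) \<le> real n * 1" using small(2) by (rule mult_left_mono) simp
    qed (use r in auto)
    finally show ?thesis using t7 by simp
  qed

  define \<rho> where "\<rho> = real r * real (card R - a) / (real n + real r * real (card R - a))"
  have \<rho>01: "0 \<le> \<rho>" "\<rho> \<le> 1"
  proof -
    have "0 < real n + real r * real (card R - a)" using n0 by (intro add_pos_nonneg) auto
    then show "0 \<le> \<rho>" "\<rho> \<le> 1" by (simp_all add: \<rho>_def)
  qed
  \<comment> \<open>One factor \<open>\<alpha>\<close> is lost in the numerator, as up to
    \<open>a\<close> relevant coordinates are used up, and one in the denominator, as
    \<open>r * m\<close> is small against \<open>n\<close>.\<close>
  have \<rho>_ge: "r * m / (\<alpha>\<^sup>2 * n) \<le> \<rho>"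
  proof -
    have d: "real (card R - a) = m - real a" using am by (simp add: m_def of_nat_diff)
    have "r * m / (\<alpha>\<^sup>2 * n) = (r * (m / \<alpha>)) / (\<alpha> * n)"
      using \<alpha> by (simp add: power2_eq_square)
    also have "\<dots> \<le> \<rho>" unfolding \<rho>_def d
    proof (rule frac_le)
      have "r * (card R / n) * n \<le> (\<alpha> - 1) * n" using small(3) by (intro mult_right_mono) auto
      then have "r * m \<le> (\<alpha> - 1) * n" using n0 by (simp add: m_def)
      moreover have "real r * (m - real a) \<le> r * m" by (simp add: mult_left_mono)
      moreover have "(\<alpha> - 1) * n = \<alpha> * n - n" by (simp add: algebra_simps)
      ultimately show "real n + real r * (m - real a) \<le> \<alpha> * n" by linarith
      show "r * (m / \<alpha>) \<le> real r * (m - real a)" using a_m by (intro mult_left_mono) auto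
      show "0 < real n + real r * (m - real a)" using n0 am by (intro add_pos_nonneg) auto
      show "0 \<le> real r * (m - real a)" using am by simp
    qed
    finally show ?thesis .
  qed
  have \<rho>t: "\<alpha> * a \<le> \<rho> * t"
  proof -
    have "\<alpha> * a \<le> \<alpha> * (\<alpha> ^ 3 * y)" using a3 \<alpha> by (intro mult_left_mono) auto
    also have "\<dots> = \<alpha> ^ 4 * (m * p)" by (simp add: ym numeral_eq_Suc)
    also have "x * (m * p) = r * m / (\<alpha>\<^sup>2 * n) * ((\<alpha>\<^sup>2 * x) * (n * p) / r)" for x
      using \<alpha> n0 r by simp
    also have "\<alpha>\<^sup>2 * \<alpha> ^ 4 = \<alpha> ^ 6" by (simp add: power_add[symmetric])
    also have "r * m / (\<alpha>\<^sup>2 * n) * (\<alpha> ^ 6 * (n * p) / r) \<le> \<rho> * t"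
      using \<rho>_ge t(1) \<alpha> p \<rho>01 by (intro mult_mono) auto
    finally show ?thesis .
  qed

  \<comment> \<open>Then \<open>1/u - 1 = (\<alpha> - 1) / 2\<close> and
    \<open>1 - u = (\<alpha> - 1) / (\<alpha> + 1)\<close>, so the slack in \<open>\<rho>t\<close>
    makes the exponent per collected coordinate negative.\<close>
  define u where "u = 2 / (1 + \<alpha>)"
  have u: "0 < u" "u < 1" using \<alpha> by (auto simp: u_def)
  have "(1/u) ^ a * (1 - \<rho> * (1 - u)) ^ t \<le> exp (real a * (1/u - 1)) * exp (real t * (- (\<rho> * (1 - u))))"
    unfolding exp_of_nat_mult
  proof (intro mult_mono power_mono)
    show "1 / u \<le> exp (1 / u - 1)" using exp_ge_add_one_self[of "1/u - 1"] by simp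
    show "1 - \<rho> * (1 - u) \<le> exp (- (\<rho> * (1 - u)))" using exp_ge_add_one_self[of "- (\<rho> * (1 - u))"] by simp
    show "0 \<le> 1 - \<rho> * (1 - u)" using \<rho>01 u by (simp add: mult_le_one)
    then show "0 \<le> (1 - \<rho> * (1 - u)) ^ t" by simp
  qed (use u in auto)
  also have "\<dots> = exp (real a * (1/u - 1) - \<rho> * t * (1 - u))"
    by (simp add: exp_add[symmetric] algebra_simps)
  also have "\<dots> \<le> exp (- (\<alpha> - 1)\<^sup>2 / (2 * (\<alpha> + 1)) * y)"
  proof -
    have "real a * (1/u - 1) - \<rho> * t * (1 - u) \<le> real a * (1/u - 1) - \<alpha> * a * (1 - u)"
      using \<rho>t u by (intro diff_left_mono mult_right_mono) auto
    also have "\<dots> = a * ((1/u - 1) - \<alpha> * (1 - u))" by (simp add: algebra_simps)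
    also have "(1/u - 1) - \<alpha> * (1 - u) = - (\<alpha> - 1)\<^sup>2 / (2 * (\<alpha> + 1))"
      using \<alpha> by (simp add: u_def field_simps power2_eq_square)
    also have "a * (- (\<alpha> - 1)\<^sup>2 / (2 * (\<alpha> + 1))) \<le> y * (- (\<alpha> - 1)\<^sup>2 / (2 * (\<alpha> + 1)))"
      using ya \<alpha> by (intro mult_right_mono_neg divide_nonpos_nonneg) auto
    finally show ?thesis by (simp add: mult.commute)
  qed
  finally have "1/2 \<le> 1 - 2 powr (-\<alpha>) - 1 / (\<alpha> * (\<alpha> - 1)\<^sup>2) / y - (1/u) ^ a * (1 - \<rho> * (1 - u)) ^ t"
    using fast by linarith
  also have "\<dots> \<le> walk_avg R a (\<lambda>X. of_bool (f X)) {} - (1/u) ^ a * (1 - \<rho> * (1 - u)) ^ t"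
    using walk_avg_ge_near_threshold[OF finR monoR p half \<alpha>, of a] a y0 by (simp add: y_def)
  also have "\<dots> \<le> measure_pmf.prob (choice_process r (greedy_policy R) n t) {h. f (state h)}"
    using R relevant_Int[of _ n f] monoR r am u \<rho>_def
    by (intro greedy_policy_success) (auto simp: R_def m_def)
  finally have success: "1/2 \<le> measure_pmf.prob (choice_process r (greedy_policy R) n t) {h. f (state h)}" .
  show "T_walk n f \<le> r * T_choice r n f"
    using mono r fullV tn valid_greedy_policy success by (rule T_walk_le_T_choice)
  have "r * T_choice r n f \<le> r * t"
    using T_choice_le[OF tn valid_greedy_policy success] by simp
  then have "real (r * T_choice r n f) \<le> r * (\<alpha> ^ 7 * (n * p) / r)"
    using t7 r by (smt (verit) mult_left_mono of_nat_0_le_iff of_nat_mono of_nat_mult)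
  also have "r * (x * (n * p) / r) = (\<alpha>\<^sup>2 * x) * (n * p / \<alpha>\<^sup>2)" for x
    using r \<alpha> by simp
  also have "\<alpha>\<^sup>2 * \<alpha> ^ 7 = \<alpha> ^ 9" by (simp add: power_add[symmetric])
  also have "\<alpha> ^ 9 * (n * p / \<alpha>\<^sup>2) \<le> \<alpha> ^ 9 * T_walk n f" using T1 \<alpha> by (intro mult_left_mono) auto
  finally show "r * T_choice r n f \<le> \<alpha> ^ 9 * T_walk n f" .
qed

section \<open>Passage to the limit\<close>

lemma root_close_to_1:
  fixes e :: real
  assumes "0 < e" "0 < k"
  obtains \<alpha> :: real where "1 < \<alpha>" "\<alpha> ^ k \<le> 1 + e"
  using that[of "root k (1 + e)"] assms by simp

theorem theorem2p7:
  fixes r :: nat and f :: "nat \<Rightarrow> nat set \<Rightarrow> bool"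
  assumes "r \<ge> 2"
    and "\<And>n. n \<ge> 1 \<Longrightarrow> monotone_boolean n (f n)"
    and "filterlim (\<lambda>n. T_walk (card (relevant n (f n))) (relevant_contraction n (f n)))
           at_top sequentially"
    and "(\<lambda>n. real (T_walk (card (relevant n (f n))) (relevant_contraction n (f n))))
           \<in> o(\<lambda>n. real (card (relevant n (f n))))"
    and "(\<lambda>n. real (card (relevant n (f n)))) \<in> o(\<lambda>n. real n)"
  shows "(\<lambda>n. real (T_choice r n (f n))) \<sim>[sequentially] (\<lambda>n. real (T_walk n (f n)) / real r)"
proof -
  define R where "R n = relevant n (f n)" for n
  define m where "m n = card (R n)" for n
  define \<tau> where "\<tau> n = hitting_time (R n) (f n)" for n
  define thr where "thr n p \<longleftrightarrow> 0 \<le> p \<and> p \<le> 1 \<and> biased (R n) p (\<lambda>X. of_bool (f n X)) = 1/2"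
    for n and p :: real
  \<comment> \<open>Meaningful only where such a bias exists, which is the case for all large
    \<open>n\<close>.\<close>
  define p where "p n = (SOME p. thr n p)" for n
  define y where "y n = m n * p n" for n
  have finR: "finite (R n)" and RV: "R n \<subseteq> {..<n}" for n
    using finite_relevant relevant_subset by (auto simp: R_def)
  have monoR: "mono_on (Pow (R n)) (\<lambda>X. of_bool (f n X) :: real)" if "n \<ge> 1" for n
    using monotone_boolean_mono_on[OF assms(2)[OF that]]
    by (rule mono_on_subset) (use RV[of n] in auto)
  have \<tau>_top: "filterlim \<tau> at_top sequentially"
    using assms(3) by (simp add: T_walk_relevant_contraction \<tau>_def[abs_def] R_def)
  have \<tau>_m: "(\<lambda>n. real (\<tau> n)) \<in> o(\<lambda>n. real (m n))"
    using assms(4) by (simp add: T_walk_relevant_contraction \<tau>_def R_def m_def)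
  have m_n: "(\<lambda>n. real (m n)) \<in> o(\<lambda>n. real n)"
    using assms(5) by (simp add: m_def R_def)

  have "\<forall>\<^sub>F n in sequentially. \<tau> n > (LEAST t. False)"
    using eventually_gt_at_top \<tau>_top by (rule eventually_compose_filterlim)
  \<comment> \<open>The two constant functions have hitting times \<open>LEAST t. False\<close> and
    0, both excluded for large \<open>n\<close>.\<close>
  then have nonconst: "\<forall>\<^sub>F n in sequentially. f n (R n) \<and> \<not> f n {} \<and> n \<ge> 1"
    using eventually_ge_at_top[of 1]
  proof eventually_elim
    case (elim n)
    then have "\<tau> n \<noteq> 0" by linarith
    then show ?case
      using elim hitting_time_never[of "R n" "f n", OF finR monoR] hitting_time_empty[of "f n" "R n"]
      by (auto simp: \<tau>_def)
  qed
  then have thr: "\<forall>\<^sub>F n in sequentially. thr n (p n)"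
  proof eventually_elim
    case (elim n)
    then obtain q where "thr n q"
      using biased_eq_half_ex[OF finR, of "\<lambda>X. of_bool (f n X)" n] by (auto simp: thr_def)
    then show ?case unfolding p_def by (rule someI)
  qed
  have good: "\<forall>\<^sub>F n in sequentially. n \<ge> 1 \<and> f n (R n) \<and> 0 \<le> p n \<and> p n \<le> 1 \<and>
      biased (R n) (p n) (\<lambda>X. of_bool (f n X)) = 1/2"
    using nonconst thr by eventually_elim (simp add: thr_def)

  have y_large: "\<forall>\<^sub>F n in sequentially. c < y n" for c
  proof -
    have "\<forall>\<^sub>F n in sequentially. nat \<lceil>4 * c + 5\<rceil> < \<tau> n"
      using eventually_gt_at_top \<tau>_top by (rule eventually_compose_filterlim)
    with good show ?thesis
    proof eventually_elim
      case (elim n)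
      then have "\<tau> n \<le> 4 * y n + 5"
        using hitting_time_le_linear[OF finR monoR, of n "p n"]
        by (simp add: \<tau>_def y_def m_def)
      moreover have "4 * c + 5 < \<tau> n" using elim by linarith
      ultimately show ?case by linarith
    qed
  qed
  then have y_top: "filterlim y at_top sequentially"
    by (simp add: filterlim_at_top_dense)
  have inv_y: "(\<lambda>n. c / y n) \<longlonglongrightarrow> 0" for c
    using y_top by (intro tendsto_divide_0[OF tendsto_const] filterlim_at_top_imp_at_infinity)

  have damp_gap: "0 < 2 powr (-1/\<alpha>) - (1/2 :: real)" if "1 < \<alpha>" for \<alpha> :: real
  proof -
    have "(2::real) powr (-1) < 2 powr (-1/\<alpha>)" using that by (intro powr_less_mono) auto
    then show ?thesis by (simp add: powr_minus_divide)
  qed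
  have boost_gap: "0 < (1/2 :: real) - 2 powr (-\<alpha>)" if "1 < \<alpha>" for \<alpha> :: real
  proof -
    have "(2::real) powr (-\<alpha>) < 2 powr (-1)" using that by (intro powr_less_mono) auto
    then show ?thesis by (simp add: powr_minus_divide)
  qed
  have slow: "\<forall>\<^sub>F n in sequentially. c / y n < 2 powr (-1/\<alpha>) - 1/2" if "1 < \<alpha>" for c \<alpha>
    using inv_y damp_gap[OF that] by (rule order_tendstoD(2))

  \<comment> \<open>On the relevant set, \<open>hitting_time_gt\<close> with
    \<open>\<alpha> = 2\<close> gives \<open>m n * p n / 4 < \<tau> n\<close>, and
    \<open>\<tau>\<close> is of smaller order than \<open>m\<close>.\<close>
  have p_0: "p \<longlonglongrightarrow> 0"
  proof (rule tendsto_sandwich)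
    show "(\<lambda>n. 0) \<longlonglongrightarrow> (0::real)" by simp
    have "(\<lambda>n. 4 * (real (\<tau> n) / real (m n))) \<longlonglongrightarrow> 4 * 0"
      by (intro tendsto_mult tendsto_const smalloD_tendsto \<tau>_m)
    then show "(\<lambda>n. 4 * (real (\<tau> n) / real (m n))) \<longlonglongrightarrow> 0" by simp
    show "\<forall>\<^sub>F n in sequentially. 0 \<le> p n" using good by eventually_elim simp
    show "\<forall>\<^sub>F n in sequentially. p n \<le> 4 * (real (\<tau> n) / real (m n))"
      using good slow[of 2 "2 ^ 4 / (2 - 1)\<^sup>2", simplified] y_large[of 0]
    proof eventually_elim
      case (elim n)
      then have "card (R n) * p n / 2\<^sup>2 < hitting_time (R n) (f n)"
        by (intro hitting_time_gt[OF finR monoR]) (auto simp: y_def m_def)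
      moreover have "m n > 0" using elim by (cases "m n = 0") (auto simp: y_def)
      ultimately show ?case by (simp add: field_simps \<tau>_def m_def)
    qed
  qed
  have p_small: "\<forall>\<^sub>F n in sequentially. c * p n \<le> d" if "0 < d" for c d
  proof -
    have "(\<lambda>n. c * p n) \<longlonglongrightarrow> c * 0" by (intro tendsto_mult tendsto_const p_0)
    then have "\<forall>\<^sub>F n in sequentially. c * p n < d" using that by (intro order_tendstoD(2)) auto
    then show ?thesis by eventually_elim simp
  qed

  \<comment> \<open>For fixed \<open>\<alpha>\<close> every hypothesis of
    \<open>T_choice_between\<close> holds eventually: \<open>y\<close> tending to infinity covers
    rounding and the error terms, \<open>p\<close> tending to 0 keeps \<open>a\<close> and
    \<open>t\<close> within range, and \<open>m n / n\<close> tending to 0 controls the hitting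
    rate.\<close>
  have between: "\<forall>\<^sub>F n in sequentially. 0 < T_walk n (f n) \<and> T_walk n (f n) \<le> r * T_choice r n (f n) \<and>
      r * T_choice r n (f n) \<le> \<alpha> ^ 9 * T_walk n (f n)" if \<alpha>: "1 < \<alpha>" for \<alpha> :: real
  proof -
    define \<kappa> where "\<kappa> = (\<alpha> - 1)\<^sup>2 / (2 * (\<alpha> + 1))"
    have \<kappa>: "0 < \<kappa>" using \<alpha> by (simp add: \<kappa>_def)
    have \<alpha>32: "0 < \<alpha> ^ 3 - \<alpha>\<^sup>2" using \<alpha> power_strict_increasing[of 2 3 \<alpha>] by simp
    have \<alpha>76: "0 < \<alpha> ^ 7 - \<alpha> ^ 6" using \<alpha> power_strict_increasing[of 6 7 \<alpha>] by simp
    have 1: "\<forall>\<^sub>F n in sequentially. 1 \<le> y n * (\<alpha> ^ 3 - \<alpha>\<^sup>2)"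
      using y_large[of "1 / (\<alpha> ^ 3 - \<alpha>\<^sup>2)"]
      by eventually_elim (use \<alpha>32 in \<open>simp add: divide_less_eq\<close>)
    have 2: "\<forall>\<^sub>F n in sequentially. 1 \<le> y n * (\<alpha> ^ 7 - \<alpha> ^ 6) / r"
      using y_large[of "r / (\<alpha> ^ 7 - \<alpha> ^ 6)"]
      by eventually_elim (use \<alpha>76 assms(1) in \<open>simp add: divide_less_eq le_divide_eq\<close>)
    have 3: "\<forall>\<^sub>F n in sequentially. \<alpha> ^ 3 * p n \<le> 1 - 1/\<alpha>"
      using \<alpha> by (intro p_small) simp
    have 4: "\<forall>\<^sub>F n in sequentially. \<alpha> ^ 7 * p n \<le> 1"
      by (intro p_small) simp
    have "(\<lambda>n. r * (real (m n) / real n)) \<longlonglongrightarrow> real r * 0"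
      by (intro tendsto_mult tendsto_const smalloD_tendsto m_n)
    then have "\<forall>\<^sub>F n in sequentially. r * (real (m n) / real n) < \<alpha> - 1"
      using \<alpha> by (intro order_tendstoD(2)) auto
    then have 5: "\<forall>\<^sub>F n in sequentially. r * (real (m n) / real n) \<le> \<alpha> - 1"
      by eventually_elim simp
    have "(\<lambda>n. exp (- \<kappa> * y n)) \<longlonglongrightarrow> 0"
      using \<kappa> y_top
      by (intro filterlim_compose[OF exp_at_bot] filterlim_tendsto_neg_mult_at_bot[OF tendsto_const]) auto
    then have "(\<lambda>n. 1 / (\<alpha> * (\<alpha> - 1)\<^sup>2) / y n + exp (- \<kappa> * y n)) \<longlonglongrightarrow> 0 + 0"
      by (intro tendsto_add inv_y)
    then have "\<forall>\<^sub>F n in sequentially. 1 / (\<alpha> * (\<alpha> - 1)\<^sup>2) / y n + exp (- \<kappa> * y n) < 1/2 - 2 powr (-\<alpha>)"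
      using boost_gap[OF \<alpha>] by (intro order_tendstoD(2)) auto
    from good 1 2 3 4 5 slow[OF \<alpha>, of "\<alpha> ^ 4 / (\<alpha> - 1)\<^sup>2"] this show ?thesis
    proof eventually_elim
      case (elim n)
      then show ?case
        using T_choice_between[of n "f n" r "p n" \<alpha>] assms(1,2) \<alpha>
        by (simp add: R_def m_def y_def \<kappa>_def)
    qed
  qed

  show ?thesis
  proof (rule asymp_equivI', rule tendstoI)
    fix e :: real assume "0 < e"
    \<comment> \<open>The exponent is that of \<open>between\<close>; using \<open>e/2\<close> makes
      the final inequality strict.\<close>
    then obtain \<alpha> :: real where \<alpha>: "1 < \<alpha>" "\<alpha> ^ 9 \<le> 1 + e/2"
      using root_close_to_1[of "e/2" 9] by auto
    show "\<forall>\<^sub>F n in sequentially. dist (real (T_choice r n (f n)) / (real (T_walk n (f n)) / real r)) 1 < e"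
      using between[OF \<alpha>(1)]
    proof eventually_elim
      case (elim n)
      define A where "A = real (T_walk n (f n))"
      define B where "B = real r * real (T_choice r n (f n))"
      have A: "0 < A" "A \<le> B" "B \<le> \<alpha> ^ 9 * A"
        using elim by (simp_all add: A_def B_def flip: of_nat_mult)
      have "\<alpha> ^ 9 * A \<le> (1 + e/2) * A" using \<alpha>(2) A(1) by (intro mult_right_mono) auto
      then have "B \<le> (1 + e/2) * A" using A by linarith
      then have "B / A \<le> 1 + e/2" "1 \<le> B / A" using A by (simp_all add: divide_le_eq)
      moreover have "real (T_choice r n (f n)) / (real (T_walk n (f n)) / real r) = B / A"
        by (simp add: A_def B_def)
      ultimately show ?case using \<open>0 < e\<close> by (simp add: dist_real_def)
    qed
  qed
qed

end
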